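(* For planar soft-stick percolation on $\mathbb Z^2$ with parameter $\varepsilon\in[0,1]$, let $\theta(\varepsilon)=\mathbb P_\varepsilon(|\mathcal C(0)|=\infty)$ be the probability that the forward cluster of the origin is infinite, and let $\varepsilon_c=\sup\{\varepsilon\in[0,1]:\theta(\varepsilon)=0\}$. Then $$\theta\left(\frac{99}{100}\right)>\frac{11}{20}.$$ In particular, $\varepsilon_c\le 0.99<1$.
   Context: Planar soft-stick percolation with parameter $\varepsilon\in[0,1]$: each vertex $x\in\mathbb Z^2$ has four outgoing arrows, one to each of its nearest neighbors $x\pm(1,0)$, $x\pm(0,1)$. Independently for each $x\in\mathbb Z^2$, choose an axis $A_x\in\{H,V\}$ (horizontal or vertical) uniformly. Conditional on $A_x$, with probability $\varepsilon$ open both outgoing arrows of $x$ along that axis; with probability $1-\varepsilon$ open exactly one of these two arrows, chosen uniformly. All other arrows leaving $x$ are closed. The law is denoted $\mathbb P_\varepsilon$. The forward cluster $\mathcal C(0)$ is the set of vertices reachable from the origin $0$ by directed paths of open arrows (including $0$ itself). *)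

theory Defs
  imports "HOL-Probability.Probability"
begin

type_synonym vertex = "int \<times> int"

datatype axis = Horizontal | Vertical

fun unit_step :: "axis \<Rightarrow> vertex" where
  "unit_step Horizontal = (1, 0)"
| "unit_step Vertical = (0, 1)"

(* Law of the set of displacements d such that the arrow from x to x + d is open,
   at a single vertex x. For e outside [0,1], bernoulli_pmf clamps its parameter. *)
definition stick_pmf :: "real \<Rightarrow> vertex set pmf" where
  "stick_pmf e = do {
     a \<leftarrow> pmf_of_set {Horizontal, Vertical};
     soft \<leftarrow> bernoulli_pmf e;
     if soft then return_pmf {unit_step a, - unit_step a}
     else do {
       d \<leftarrow> pmf_of_set {unit_step a, - unit_step a};
       return_pmf {d}
     }
   }"

definition soft_stick_measure :: "real \<Rightarrow> (vertex \<Rightarrow> vertex set) measure" where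
  "soft_stick_measure e = (\<Pi>\<^sub>M x\<in>UNIV. measure_pmf (stick_pmf e))"

definition open_arrows :: "(vertex \<Rightarrow> vertex set) \<Rightarrow> (vertex \<times> vertex) set" where
  "open_arrows w = {(x, x + d) | x d. d \<in> w x}"

definition forward_cluster :: "(vertex \<Rightarrow> vertex set) \<Rightarrow> vertex \<Rightarrow> vertex set" where
  "forward_cluster w x = (open_arrows w)\<^sup>* `` {x}"

definition percolation_prob :: "real \<Rightarrow> real" where
  "percolation_prob e =
     measure (soft_stick_measure e)
       {w \<in> space (soft_stick_measure e). infinite (forward_cluster w 0)}"

(* The set is nonempty, as it contains 0, so Sup is the genuine supremum. *)
definition critical_parameter :: real where
  "critical_parameter = Sup {e \<in> {0..1}. percolation_prob e = 0}"

end

theory Submission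
  imports Defs
begin

text \<open>
Suppose that the forward cluster C of the origin is finite. All arrows that leave C are closed, and
a walk along the outer boundary of C, clockwise and with its left hand on the complement, passes
the tails of many of them. Where the boundary is straight, a vertex has one closed side, or two
opposite ones, and this has probability about 1/2. Where the walk turns around an outward corner, two
perpendicular arrows of the same vertex are closed; then the vertex is not soft, and the
probability is at most (1 - e) / 2. An inward turn costs nothing in addition.

The boundary walks with n visits to vertices are exponentially many, and without further
information their total probability would diverge, because at each vertex both the straight
continuation and the inward turn are possible. But the tangent of the outer boundary makes exactly
one full turn, so that outward corners exceed inward turns by four: each inward turn has to be paid
for by a corner. Multiplying the weight of a walk by 6 for each corner and by 1/6 for each inward turn
changes it by the factor 6^4 and reduces the total weight per visit to 966/1000 < 1. The walk
surrounds the origin and starts at the last vertex of C above it, so there are at most n/2 + 1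
starting points. Summation over n gives less than 9/20 for the probability of a finite cluster, for
each e between 99/100 and 1; this is percolation_lower_bound.

Two facts of plane topology carry the geometry. The lemma umlaufsatz is the theorem of turning
tangents for lattice polygons, proved by a discrete form of Hopf's secant argument. The lemma
orbit_reaches_origin_row shows by a winding number that the walk encloses the origin.
They enter the probabilistic part only through circuit_exists.

For the critical parameter it remains to see that the set in its definition is nonempty: without
soft vertices the cluster is a path that is infinite with probability zero.
\<close>

section \<open>Turning tangents of lattice polygons\<close>

definition turn :: "vertex \<Rightarrow> vertex" where
  "turn v = (snd v, - fst v)"

definition heading :: "int \<Rightarrow> vertex" where
  "heading h = (if h mod 4 = 0 then (1, 0) else if h mod 4 = 1 then (0, -1)
                else if h mod 4 = 2 then (-1, 0) else (0, 1))"

abbreviation units :: "vertex set" where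
  "units \<equiv> {(1, 0), (0, -1), (-1, 0), (0, 1)}"

lemma heading_in_units: "heading h \<in> units"
  by (simp add: heading_def)

lemma turn_turn [simp]: "turn (turn v) = - v"
  by (simp add: turn_def prod_eq_iff)

lemma turn_uminus [simp]: "turn (- v) = - turn v"
  by (simp add: turn_def prod_eq_iff)

lemma turn_heading: "turn (heading h) = heading (h + 1)"
proof -
  have "h mod 4 = 0 \<or> h mod 4 = 1 \<or> h mod 4 = 2 \<or> h mod 4 = 3" by presburger
  moreover have "(h + 1) mod 4 = (h mod 4 + 1) mod 4" by presburger
  ultimately show ?thesis unfolding heading_def by (elim disjE; simp add: turn_def)
qed

text \<open>
The signed crossings of the upward vertical half-line between the columns 0 and 1, clockwise
crossings counting positively. For lattice paths that avoid the origin these counts measure the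
change of the polar angle in full turns, so no real angles are needed.
\<close>

definition crossing :: "vertex \<Rightarrow> vertex \<Rightarrow> int" where
  "crossing u v = (if 0 < snd u \<and> snd u = snd v
     then of_bool (fst u = 0 \<and> fst v = 1) - of_bool (fst u = 1 \<and> fst v = 0) else 0)"

text \<open>
Angles along the boundary of a unit square without the origin among its corners add up to zero.
This is the lattice form of homotopy invariance.
\<close>

lemma crossing_square:
  assumes "a \<in> units" "b \<in> units" "u \<noteq> 0" "u + a \<noteq> 0" "u + b \<noteq> 0" "u + a + b \<noteq> 0"
  shows "crossing u (u + a) + crossing (u + a) (u + a + b)
       = crossing u (u + b) + crossing (u + b) (u + a + b)"
proof (cases u)
  case (Pair x y)
  have "a = (1, 0) \<or> a = (0, -1) \<or> a = (-1, 0) \<or> a = (0, 1)" and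
    "b = (1, 0) \<or> b = (0, -1) \<or> b = (-1, 0) \<or> b = (0, 1)" using assms(1,2) by auto
  then show ?thesis using assms(3-6) unfolding Pair
    by (elim disjE; simp add: crossing_def zero_prod_def; arith)
qed

text \<open>
A path that avoids the upward half-line stays in a simply connected region, on which the crossings
of the opposite half-line have a potential. Negating the path turns them into crossings of the
upward half-line.
\<close>

lemma crossing_avoiding_ray:
  assumes "a \<in> units" "u \<noteq> 0" "u + a \<noteq> 0"
    and "\<not> (fst u = 0 \<and> 0 < snd u)" "\<not> (fst (u + a) = 0 \<and> 0 < snd (u + a))"
  shows "crossing (- u) (- (u + a)) = of_bool (fst (u + a) \<le> -1) - of_bool (fst u \<le> -1)"
proof (cases u)
  case (Pair x y)
  have "a = (1, 0) \<or> a = (0, -1) \<or> a = (-1, 0) \<or> a = (0, 1)" using assms(1) by auto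
  then show ?thesis using assms(2-) unfolding Pair
    by (elim disjE; simp add: crossing_def zero_prod_def; arith)
qed

text \<open>
If integers label the four directions clockwise, with East = 0 modulo 4, then turning from one
direction to a neighbouring one crosses the upward half-line exactly when a multiple of 4 is passed.
\<close>

lemma crossing_turn:
  assumes "\<bar>h' - h\<bar> \<le> 1"
  shows "crossing (heading h) (heading h + heading h')
       + crossing (heading h + heading h') (heading h') = h' div 4 - h div 4"
proof -
  define r q where "r = h mod 4" and "q = h div 4"
  have h: "h = 4 * q + r" "0 \<le> r" "r < 4" by (auto simp: r_def q_def)
  have r: "r = 0 \<or> r = 1 \<or> r = 2 \<or> r = 3" using h by arith
  define s where "s = h' - h"
  have s: "h' = 4 * q + r + s" "s = -1 \<or> s = 0 \<or> s = 1"
    using assms h by (auto simp: s_def)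
  have *: "heading (4 * q + k) = heading k" "(4 * q + k) div 4 = q + k div 4" for k
    by (simp_all add: heading_def)
  show ?thesis using r s(2) unfolding h(1) s(1) add.assoc *
    by (elim disjE; simp add: heading_def crossing_def)
qed

text \<open>
The theorem of turning tangents for simple closed lattice polygons, by Hopf's secant argument. The
secants from point i to point j, for i < j, form a triangular array, and neighbouring entries of
the array bound unit squares that avoid the origin. Hence the diagonal of the array, where the
secants are the successive steps and the crossings count the turning of the tangent, carries the
same total as its other two sides. Those sides consist of the secants at the base point and of
their negatives. They are controlled as soon as one half-line from the base point is free of the
polygon, because a path that avoids a half-line has an explicit angle function.
\<close>

lemma umlaufsatz:
  fixes p :: "nat \<Rightarrow> vertex" and H :: "nat \<Rightarrow> int"
  assumes step: "\<And>i. i < N \<Longrightarrow> p (Suc i) = p i + heading (H i)"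
    and turns: "\<And>i. i < N \<Longrightarrow> \<bar>H (Suc i) - H i\<bar> \<le> 1"
    and closed: "p N = p 0" "heading (H N) = heading (H 0)"
    and simple: "inj_on p {..<N}" and "0 < N"
    and free: "\<And>i y. i < N \<Longrightarrow> 0 < y \<Longrightarrow> p i \<noteq> p 0 + (0, y)"
    and H0: "H 0 = 0"
  shows "H N = 4"
proof -
  have nz: "heading h \<noteq> 0" for h by (simp add: heading_def zero_prod_def)
  have N3: "3 \<le> N"
  proof (rule ccontr)
    assume "\<not> ?thesis"
    then consider "N = 1" | "N = 2" using \<open>0 < N\<close> by linarith
    then show False
    proof cases
      case 1
      then show False using step[of 0] closed(1) nz by simp
    next
      case 2
      then have "heading (H 1) = - heading (H 0)"
        using step[of 0] step[of 1] closed(1) by (simp add: numeral_2_eq_2 eq_neg_iff_add_eq_0 add.commute)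
      moreover have "H 1 = -1 \<or> H 1 = 0 \<or> H 1 = 1" using turns[of 0] 2 H0 by auto
      ultimately show False using H0 by (auto simp: heading_def)
    qed
  qed
  define v where "v i j = p j - p i" for i j
  have v_ne: "v i j \<noteq> 0" if "i < j" "j \<le> N" "i \<noteq> 0 \<or> j \<noteq> N" for i j
  proof (cases "j = N")
    case True
    then show ?thesis using that closed(1) inj_onD[OF simple, of 0 i] \<open>0 < N\<close> by (auto simp: v_def)
  next
    case False
    then show ?thesis using that inj_onD[OF simple, of j i] by (auto simp: v_def)
  qed
  have v_snd: "v i (Suc j) = v i j + heading (H j)" if "j < N" for i j
    using step[OF that] by (simp add: v_def)
  have v_fst: "v (Suc i) j = v i j + - heading (H i)" if "i < N" for i j
    using step[OF that] by (simp add: v_def)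
  have neg_units: "- heading h \<in> units" for h by (simp add: heading_def)
  (* The total crossing along column j of the array of secants, from row a to the diagonal. *)
  define col where "col a j = (\<Sum>i=a..<j-1. crossing (v i j) (v (Suc i) j))" for a j
  define K where "K i = H i div 4" for i
  have diag: "crossing (v (j-1) j) (v (j-1) (Suc j)) + crossing (v (j-1) (Suc j)) (v j (Suc j))
      = K j - K (j-1)" if "0 < j" "j < N" for j
  proof -
    have a: "v (j-1) j = heading (H (j-1))" "v j (Suc j) = heading (H j)"
      using step[of "j-1"] step[of j] that by (auto simp: v_def)
    then have "v (j-1) (Suc j) = heading (H (j-1)) + heading (H j)" using v_snd[of j "j-1"] that by simp
    then show ?thesis using crossing_turn[of "H j" "H (j-1)"] turns[of "j-1"] that a by (simp add: K_def)
  qed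
  (* Replace column j by column j + 1: the region between them is tiled by unit squares. *)
  have ladder: "col a j + (K j - K (j-1)) = crossing (v a j) (v a (Suc j)) + col a (Suc j)"
    if "a < j" "j < N" "a \<noteq> 0 \<or> Suc j \<noteq> N" for a j
  proof -
    have "a \<le> j - 1" using that by simp
    then show ?thesis using that(3)
    proof (induction rule: inc_induct)
      case base
      have "{j - 1..<Suc j - 1} = {j - 1}" using that by auto
      then show ?case using diag[of j] that base by (simp add: col_def)
    next
      case (step i)
      have *: "crossing (v i j) (v (Suc i) j) + crossing (v (Suc i) j) (v (Suc i) (Suc j))
        = crossing (v i j) (v i (Suc j)) + crossing (v i (Suc j)) (v (Suc i) (Suc j))"
      proof -
        have sq: "v i (Suc j) = v i j + heading (H j)" "v (Suc i) j = v i j + - heading (H i)"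
          "v (Suc i) (Suc j) = v i j + - heading (H i) + heading (H j)"
          using v_snd[of j i] v_snd[of j "Suc i"] v_fst[of i j] step that by auto
        have nz: "v i j \<noteq> 0" "v (Suc i) j \<noteq> 0" "v i (Suc j) \<noteq> 0" "v (Suc i) (Suc j) \<noteq> 0"
          by (rule v_ne; use step that in linarith)+
        show ?thesis using nz unfolding sq
          by (intro crossing_square[OF neg_units heading_in_units])
      qed
      have c: "col i j' = crossing (v i j') (v (Suc i) j') + col (Suc i) j'" if "i < j' - 1" for j'
        using that by (simp add: col_def sum.atLeast_Suc_lessThan)
      from step have "i < j - 1" "i < Suc j - 1" by auto
      then show ?case using c[of j] c[of "Suc j"] step.IH * by simp
    qed
  qed
  have avoid: "\<not> (fst (v 0 i) = 0 \<and> 0 < snd (v 0 i))" if "i < N" for i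
    using free[OF that, of "snd (v 0 i)"] by (auto simp: v_def prod_eq_iff)
  (* The secants at the base point avoid the upward half-line and cross nothing. *)
  have side1: "crossing (v 0 j) (v 0 (Suc j)) = 0" if "Suc j < N" for j
    using avoid[of j] avoid[of "Suc j"] that by (auto simp: crossing_def)
  have "col 0 j = K (j-1) - K 0" if "1 \<le> j" "j < N" for j
    using that
  proof (induction j rule: dec_induct)
    case base
    then show ?case by (simp add: col_def)
  next
    case (step j)
    then show ?case using ladder[of 0 j] side1[of j] by simp
  qed
  from this[of "N-1"] have A: "col 0 (N-1) = K (N-2) - K 0" using N3
    by (simp add: numeral_2_eq_2)
  have N1: "Suc (N-1) = N" "N - 1 - 1 = N - 2" using N3 by auto
  (* The entry (0, N) is the zero vector, so the last column is entered from the entry (1, N). *)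
  have B: "col 0 (N-1) = crossing (v 0 (N-1)) (v 1 (N-1)) + col 1 (N-1)"
    using N3 by (simp add: col_def sum.atLeast_Suc_lessThan)
  have C: "col 1 (N-1) + (K (N-1) - K (N-2)) = crossing (v 1 (N-1)) (v 1 N) + col 1 N"
    using ladder[of 1 "N-1"] N3 N1 by simp
  (* The last column consists of the negated secants at the base point. *)
  define \<phi> :: "vertex \<Rightarrow> int" where "\<phi> u = of_bool (fst u \<le> -1)" for u
  have "col 1 N = (\<Sum>i=1..<N-1. \<phi> (v 0 (Suc i)) - \<phi> (v 0 i))"
    unfolding col_def
  proof (intro sum.cong refl)
    fix i assume "i \<in> {1..<N-1}"
    then have i: "0 < i" "i < N" "Suc i < N" by auto
    have neg: "v i N = - v 0 i" "v (Suc i) N = - (v 0 i + heading (H i))"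
      and nxt: "v 0 (Suc i) = v 0 i + heading (H i)"
      using closed(1) v_snd[of i 0] i by (simp_all add: v_def)
    show "crossing (v i N) (v (Suc i) N) = \<phi> (v 0 (Suc i)) - \<phi> (v 0 i)"
      unfolding neg nxt \<phi>_def
    proof (rule crossing_avoiding_ray[OF heading_in_units])
      show "v 0 i \<noteq> 0" using v_ne[of 0 i] i by simp
      show "v 0 i + heading (H i) \<noteq> 0" unfolding nxt[symmetric] using v_ne[of 0 "Suc i"] i by simp
      show "\<not> (fst (v 0 i) = 0 \<and> 0 < snd (v 0 i))" using avoid i by blast
      show "\<not> (fst (v 0 i + heading (H i)) = 0 \<and> 0 < snd (v 0 i + heading (H i)))"
        unfolding nxt[symmetric] using avoid i by blast
    qed
  qed
  also have "\<dots> = \<phi> (v 0 (N-1)) - \<phi> (v 0 1)"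
    using N3 sum_Suc_diff'[of 1 "N-1" "\<lambda>i. \<phi> (v 0 i)"] by simp
  finally have D: "col 1 N = \<phi> (v 0 (N-1)) - \<phi> (v 0 1)" .
  define e where "e = heading (H (N-1))"
  have h0: "heading (H 0) = (1, 0)" using H0 by (simp add: heading_def)
  have "p (Suc 0) = p 0 + (1, 0)" using step[of 0] N3 h0 by simp
  moreover have "p N = p (N-1) + e" using step[of "N-1"] N1 N3 by (simp add: e_def)
  ultimately have w: "v 0 1 = (1, 0)" "v 0 (N-1) = - e" "v 1 (N-1) = - e - (1, 0)" "v 1 N = - (1, 0)"
    using closed(1) by (simp_all add: v_def)
  have eu: "e \<in> units" using heading_in_units by (simp add: e_def)
  have t: "\<bar>H N - H (N-1)\<bar> \<le> 1" using turns[of "N-1"] N1 N3 by simp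
  have hN: "H N mod 4 = 0" using closed(2) h0 by (simp add: heading_def split: if_splits)
  have "e \<noteq> (0, -1)" using avoid[of "N-1"] w N3 by auto
  moreover have "e \<noteq> (-1, 0)" using t hN by (auto simp: e_def heading_def split: if_splits; presburger)
  ultimately consider "e = (1, 0)" | "e = (0, 1)" using eu by auto
  then show ?thesis
  proof cases
    case 1
    then have "K (N-1) = 1" using A B C D w H0 by (simp add: crossing_def \<phi>_def K_def)
    moreover have "H (N-1) mod 4 = 0" using 1 by (simp add: e_def heading_def split: if_splits)
    ultimately show ?thesis using t hN unfolding K_def by presburger
  next
    case 2
    then have "K (N-1) = 0" using A B C D w H0 by (simp add: crossing_def \<phi>_def K_def)
    moreover have "H (N-1) mod 4 = 3" using 2 by (auto simp: e_def heading_def split: if_splits; presburger)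
    ultimately show ?thesis using t hN unfolding K_def by presburger
  qed
qed

section \<open>Walking along the boundary of a finite set of vertices\<close>

text \<open>
Each vertex is blown up to a two by two block of corners, and a boundary walk visits corners rather
than vertices. This separates the two sides of a vertex that a walk may pass twice, and it makes
the walk a simple polygon even where two vertices of the set touch diagonally. The corner at the
upper left of its block faces North, and the next ones clockwise face East, South and West.
\<close>

definition cell :: "vertex \<Rightarrow> vertex" where
  "cell p = (fst p div 2, snd p div 2)"

definition front :: "vertex \<Rightarrow> vertex" where
  "front p = (if even (fst p) then (if even (snd p) then (-1, 0) else (0, 1))
              else (if even (snd p) then (0, -1) else (1, 0)))"

definition pass :: "vertex \<Rightarrow> vertex" where
  "pass p = p + front p"

definition slide :: "vertex \<Rightarrow> vertex" where
  "slide p = p + turn (front p)"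

text \<open>
The walk keeps its left hand on the complement of C. At each corner it tries to leave the block in
the direction that the corner faces; when the neighbour there does not belong to C, it slides along
that side to the next corner of the block. The facing direction replaces the direction of arrival, so the
walk is the iteration of a map on corners.
\<close>

definition hug :: "vertex set \<Rightarrow> vertex \<Rightarrow> vertex" where
  "hug C p = (if cell p + front p \<in> C then pass p else slide p)"

lemma front_in_units: "front p \<in> units"
  by (simp add: front_def)

lemma parity_cases:
  fixes p :: vertex
  obtains a b where "p = (2 * a, 2 * b)" | a b where "p = (2 * a, 2 * b + 1)"
  | a b where "p = (2 * a + 1, 2 * b)" | a b where "p = (2 * a + 1, 2 * b + 1)"
  by (metis (no_types) evenE oddE surj_pair)

lemma front_slide [simp]: "front (slide p) = turn (front p)"
  and front_pass [simp]: "front (pass p) = - turn (front p)"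
  and cell_slide [simp]: "cell (slide p) = cell p"
  and cell_pass [simp]: "cell (pass p) = cell p + front p"
  and cell_pass_slide: "cell (pass p + turn (front p)) = cell p + front p"
  and slide4: "slide (slide (slide (slide p))) = p"
  by (cases p rule: parity_cases; simp add: front_def slide_def pass_def turn_def cell_def)+

lemma corner_eqI: "cell p = cell q \<Longrightarrow> front p = front q \<Longrightarrow> p = q"
  by (cases p rule: parity_cases; cases q rule: parity_cases; simp add: front_def cell_def)

lemma hug_pass: "cell p + front p \<in> C \<Longrightarrow> hug C p = pass p"
  and hug_slide: "cell p + front p \<notin> C \<Longrightarrow> hug C p = slide p"
  by (simp_all add: hug_def)

text \<open>
The walk can be traced backwards, so its orbits in a finite set are cycles.
\<close>

definition unhug :: "vertex set \<Rightarrow> vertex \<Rightarrow> vertex" where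
  "unhug C q = (if cell (q - turn (front q)) \<in> C then q - turn (front q) else q - front q)"

lemma unhug_hug:
  assumes "cell p \<in> C"
  shows "unhug C (hug C p) = p"
proof (cases "cell p + front p \<in> C")
  case True
  have "pass p - turn (- turn (front p)) = p" by (simp add: pass_def)
  then show ?thesis using True assms by (simp add: hug_def unhug_def)
next
  case False
  have "slide p - turn (turn (front p)) = pass p + turn (front p)"
    by (simp add: slide_def pass_def algebra_simps)
  moreover have "slide p - turn (front p) = p" by (simp add: slide_def)
  ultimately show ?thesis using False by (simp add: hug_def unhug_def cell_pass_slide)
qed

text \<open>
A boundary walk is cut into visits. A visit (k, l) slides along k consecutive sides of one block,
hence around k - 1 outward corners, and then passes l times: once to continue straight into the
neighbouring block, twice to make an inward turn into the diagonally adjacent block. The list of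
all visits determines the walk without reference to C, and these lists are what is counted below.
\<close>

definition next_visit :: "nat \<times> nat \<Rightarrow> vertex \<Rightarrow> vertex" where
  "next_visit v p = (pass ^^ snd v) ((slide ^^ fst v) p)"

primrec run :: "(nat \<times> nat) list \<Rightarrow> vertex \<Rightarrow> vertex" where
  "run [] p = p"
| "run (v # vs) p = run vs (next_visit v p)"

abbreviation visit_at :: "(nat \<times> nat) list \<Rightarrow> vertex \<Rightarrow> nat \<Rightarrow> vertex" where
  "visit_at vs p i \<equiv> run (take i vs) p"

lemma run_append: "run (us @ vs) p = run vs (run us p)"
  by (induction us arbitrary: p) auto

definition closed_sides :: "vertex \<Rightarrow> nat \<Rightarrow> vertex set" where
  "closed_sides p k = (\<lambda>i. (turn ^^ i) (front p)) ` {..<k}"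

abbreviation visits :: "(nat \<times> nat) set" where
  "visits \<equiv> {1..3} \<times> {1..2}"

text \<open>
A visit starts at a corner whose side is blocked and which was not reached by sliding.
\<close>

definition is_start :: "vertex set \<Rightarrow> vertex \<Rightarrow> bool" where
  "is_start C p \<longleftrightarrow> cell p \<in> C \<and> cell p + front p \<notin> C \<and> cell p - turn (front p) \<in> C"

text \<open>
The change of the facing direction in quarter turns: a slide turns clockwise, a pass
counterclockwise.
\<close>

definition spin :: "vertex set \<Rightarrow> vertex \<Rightarrow> int" where
  "spin C p = (if cell p + front p \<in> C then -1 else 1)"

text \<open>
The last condition makes k the full number of consecutive blocked sides.
\<close>

definition obeys :: "vertex set \<Rightarrow> vertex \<Rightarrow> nat \<Rightarrow> bool" where
  "obeys C p k \<longleftrightarrow> is_start C p \<and> (\<forall>d \<in> closed_sides p k. cell p + d \<notin> C)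
     \<and> cell p + (turn ^^ k) (front p) \<in> C"

text \<open>
At most three sides are blocked, since the neighbour counterclockwise of the first blocked side
belongs to C. After two passes the walk faces a corner of the block on whose side it has just slid,
which is blocked; so a third pass never occurs.
\<close>

lemma visit_exists:
  assumes "is_start C p"
  obtains v where "v \<in> visits" "obeys C p (fst v)"
    "(hug C ^^ (fst v + snd v)) p = next_visit v p" "is_start C (next_visit v p)"
    "\<And>i. 0 < i \<Longrightarrow> i < fst v + snd v \<Longrightarrow> \<not> is_start C ((hug C ^^ i) p)"
    "(\<Sum>i<fst v + snd v. spin C ((hug C ^^ i) p)) = int (fst v) - int (snd v)"
    "\<And>i. i < fst v + snd v \<Longrightarrow> spin C ((hug C ^^ i) p) = 1 \<Longrightarrow> cell ((hug C ^^ i) p) = cell p"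
proof -
  define x f where "x = cell p" and "f = front p"
  have p: "cell p = x" "front p = f" by (auto simp: x_def f_def)
  have st: "x \<in> C" "x + f \<notin> C" "x - turn f \<in> C" using assms by (auto simp: is_start_def p)
  have slides: "cell ((slide ^^ i) p) = x" "front ((slide ^^ i) p) = (turn ^^ i) f" for i
    by (induction i) (auto simp: p)
  have "\<exists>k. k \<in> {1..3} \<and> (\<forall>i<k. x + (turn ^^ i) f \<notin> C) \<and> x + (turn ^^ k) f \<in> C"
  proof -
    have t: "(turn ^^ 1) f = turn f" "(turn ^^ 2) f = - f" "(turn ^^ 3) f = - turn f"
      by (auto simp: numeral_eq_Suc)
    consider "x + turn f \<in> C" | "x + turn f \<notin> C" "x - f \<in> C" | "x + turn f \<notin> C" "x - f \<notin> C" by blast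
    then show ?thesis
    proof cases
      case 1 then show ?thesis using st t by (intro exI[of _ 1]) auto
    next
      case 2 then show ?thesis using st t by (intro exI[of _ 2]) (auto simp: less_Suc_eq numeral_2_eq_2)
    next
      case 3 then show ?thesis using st t by (intro exI[of _ 3]) (auto simp: less_Suc_eq numeral_3_eq_3)
    qed
  qed
  then obtain k where k: "k \<in> {1..3}" "\<And>i. i < k \<Longrightarrow> x + (turn ^^ i) f \<notin> C" "x + (turn ^^ k) f \<in> C"
    by blast
  have hs: "(hug C ^^ i) p = (slide ^^ i) p" if "i \<le> k" for i
    using that by (induction i) (auto simp: hug_slide slides k)
  have sp: "spin C ((hug C ^^ i) p) = 1" if "i < k" for i
    using that k(2) by (auto simp: hs spin_def slides)
  define q where "q = (slide ^^ k) p"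
  have q: "cell q = x" "front q = (turn ^^ k) f" by (simp_all add: q_def slides)
  have hk: "(hug C ^^ k) p = q" by (simp add: hs q_def)
  have spk: "spin C q = -1" using k(3) by (simp add: spin_def q)
  have h1: "(hug C ^^ Suc k) p = pass q" using k(3) by (simp add: hk hug_pass q)
  define g where "g = (turn ^^ (k - 1)) f"
  have tg: "turn g = front q" "turn (front q) = - g"
    using k(1) by (cases k; simp add: g_def q)+
  have gC: "x + g \<notin> C" using k(1,2) by (auto simp: g_def)
  have ns: "\<not> is_start C ((hug C ^^ i) p)" if "0 < i" "i \<le> k" for i
  proof (cases "i = k")
    case True
    then show ?thesis using k(3) by (simp add: hk is_start_def q)
  next
    case False
    define j where "j = i - 1"
    have j: "i = Suc j" "j < k" "Suc j < k" using that False by (auto simp: j_def)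
    have "(turn ^^ i) f = turn ((turn ^^ j) f)" "(hug C ^^ i) p = (slide ^^ i) p"
      using hs[OF that(2)] by (simp add: j(1), blast)
    then show ?thesis using k(2)[of j] j by (simp add: is_start_def slides)
  qed
  have nq: "\<not> is_start C q" using k(3) by (simp add: is_start_def q)
  have ob: "obeys C p k" using k(2,3) assms by (auto simp: obeys_def closed_sides_def p)
  have sumk: "(\<Sum>i<k. spin C ((hug C ^^ i) p)) = int k" using sp by simp
  show thesis
  proof (cases "x + front q + g \<in> C")
    case False
    have "is_start C (pass q)" using False k(3) st(1) tg by (simp add: is_start_def q)
    then show thesis using k(1) ob h1 ns nq sumk spk hs slides
      by (intro that[of "(k, 1)"]) (auto simp: next_visit_def hk less_Suc_eq x_def[symmetric] simp flip: q_def)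
  next
    case True
    have h2: "(hug C ^^ Suc (Suc k)) p = pass (pass q)"
      using h1 True tg by (simp add: hug_pass q)
    have s1: "spin C (pass q) = -1" using True tg by (simp add: spin_def q)
    have ns1: "\<not> is_start C (pass q)" using True tg by (simp add: is_start_def q)
    have "is_start C (pass (pass q))" using True k(3) gC tg
      by (simp add: is_start_def q)
    then show thesis using k(1) ob h1 h2 ns nq ns1 sumk spk s1 hs slides
      by (intro that[of "(k, 2)"]) (auto simp: next_visit_def hk less_Suc_eq x_def[symmetric] numeral_2_eq_2 simp flip: q_def)
  qed
qed

section \<open>The outer boundary walk of a finite cluster\<close>

text \<open>
The list vs records the first M steps of the walk from p. Its starting corners are distinct points of
the orbit, and its blocks include every block in which the walk slides.
\<close>

definition itinerary :: "vertex set \<Rightarrow> vertex \<Rightarrow> nat \<Rightarrow> (nat \<times> nat) list \<Rightarrow> bool" where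
  "itinerary C p M vs \<longleftrightarrow> set vs \<subseteq> visits \<and> run vs p = (hug C ^^ M) p
    \<and> (\<Sum>v\<leftarrow>vs. int (fst v) - int (snd v)) = (\<Sum>i<M. spin C ((hug C ^^ i) p))
    \<and> (\<forall>i<length vs. obeys C (visit_at vs p i) (fst (vs ! i)))
    \<and> (\<forall>i<length vs. \<exists>t<M. visit_at vs p i = (hug C ^^ t) p)
    \<and> (\<forall>i<length vs. \<forall>j<i. visit_at vs p i \<noteq> visit_at vs p j)
    \<and> (\<forall>t<M. spin C ((hug C ^^ t) p) = 1 \<longrightarrow>
         (\<exists>i<length vs. cell (visit_at vs p i) = cell ((hug C ^^ t) p)))"

lemma itinerary_exists:
  assumes "is_start C p" "is_start C ((hug C ^^ M) p)" "inj_on (\<lambda>i. (hug C ^^ i) p) {..<M}"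
  shows "\<exists>vs. itinerary C p M vs"
  using assms
proof (induction M arbitrary: p rule: less_induct)
  case (less M)
  show ?case
  proof (cases "M = 0")
    case True
    then show ?thesis by (intro exI[of _ "[]"]) (auto simp: itinerary_def)
  next
    case False
    obtain v where v: "v \<in> visits" "obeys C p (fst v)"
      "(hug C ^^ (fst v + snd v)) p = next_visit v p" "is_start C (next_visit v p)"
      "\<And>i. 0 < i \<Longrightarrow> i < fst v + snd v \<Longrightarrow> \<not> is_start C ((hug C ^^ i) p)"
      "(\<Sum>i<fst v + snd v. spin C ((hug C ^^ i) p)) = int (fst v) - int (snd v)"
      "\<And>i. i < fst v + snd v \<Longrightarrow> spin C ((hug C ^^ i) p) = 1 \<Longrightarrow> cell ((hug C ^^ i) p) = cell p"
      using visit_exists[OF less.prems(1)] by metis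
    define l where "l = fst v + snd v"
    have l: "0 < l" "l \<le> M"
      using v(1) v(5)[of M] less.prems(2) False unfolding l_def by (cases v; fastforce)+
    define q where "q = next_visit v p"
    have shift: "(hug C ^^ i) q = (hug C ^^ (i + l)) p" for i
      using v(3) by (simp add: funpow_add q_def l_def)
    have inj: "inj_on (\<lambda>i. (hug C ^^ i) q) {..<M - l}"
      unfolding shift
    proof (rule inj_onI)
      fix i j assume "i \<in> {..<M - l}" "j \<in> {..<M - l}" "(hug C ^^ (i + l)) p = (hug C ^^ (j + l)) p"
      then show "i = j" using inj_onD[OF less.prems(3), of "i + l" "j + l"] by auto
    qed
    have end_q: "(hug C ^^ (M - l)) q = (hug C ^^ M) p" using l by (simp add: shift)
    have q: "is_start C q" "is_start C ((hug C ^^ (M - l)) q)" "M - l < M"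
      using v(4) less.prems(2) end_q l by (simp_all add: q_def)
    obtain vs where it: "itinerary C q (M - l) vs" using less.IH[OF q(3,1,2) inj] by blast
    have vs: "set vs \<subseteq> visits" "run vs q = (hug C ^^ M) p"
      "(\<Sum>v\<leftarrow>vs. int (fst v) - int (snd v)) = (\<Sum>i<M - l. spin C ((hug C ^^ i) q))"
      using it unfolding itinerary_def end_q by blast+
    have vs_obeys: "obeys C (visit_at vs q i) (fst (vs ! i))"
      and vs_orbit: "\<exists>t<M - l. visit_at vs q i = (hug C ^^ t) q"
      and vs_distinct: "j < i \<Longrightarrow> visit_at vs q i \<noteq> visit_at vs q j" if "i < length vs" for i j
      using it that unfolding itinerary_def by blast+
    have vs_cover: "\<exists>i<length vs. cell (visit_at vs q i) = cell ((hug C ^^ t) q)"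
      if "t < M - l" "spin C ((hug C ^^ t) q) = 1" for t
      using it that unfolding itinerary_def by blast
    have at_Suc: "visit_at (v # vs) p (Suc i) = visit_at vs q i" for i by (simp add: q_def)
    have "(\<Sum>i<l + n. g i) = (\<Sum>i<l. g i) + (\<Sum>i<n. g (i + l))" for n and g :: "nat \<Rightarrow> int"
      by (induction n) (simp_all add: add.commute add.left_commute)
    from this[where n="M - l"] have sum: "(\<Sum>i<M. spin C ((hug C ^^ i) p))
        = (\<Sum>i<l. spin C ((hug C ^^ i) p)) + (\<Sum>i<M - l. spin C ((hug C ^^ i) q))"
      unfolding shift using l(2) by simp
    have later: "\<exists>t<M. 0 < t \<and> visit_at vs q i = (hug C ^^ t) p" if i: "i < length vs" for i
    proof -
      obtain t where "t < M - l" "visit_at vs q i = (hug C ^^ t) q" using vs_orbit[OF i] by blast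
      then show ?thesis using l unfolding shift by (intro exI[of _ "t + l"]) auto
    qed
    have new: "visit_at vs q i \<noteq> p" if i: "i < length vs" for i
    proof -
      obtain t where "t < M" "0 < t" "visit_at vs q i = (hug C ^^ t) p" using later[OF i] by blast
      then show ?thesis using inj_onD[OF less.prems(3), of t 0] by auto
    qed
    have cover: "\<exists>i<length (v # vs). cell (visit_at (v # vs) p i) = cell ((hug C ^^ t) p)"
      if t: "t < M" "spin C ((hug C ^^ t) p) = 1" for t
    proof (cases "t < l")
      case True
      then show ?thesis using v(7)[of t] t by (intro exI[of _ 0]) (auto simp: l_def)
    next
      case False
      then have "(hug C ^^ (t - l)) q = (hug C ^^ t) p" "t - l < M - l" using t(1) by (simp_all add: shift)
      then obtain i where "i < length vs" "cell (visit_at vs q i) = cell ((hug C ^^ t) p)"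
        using vs_cover[of "t - l"] t False by auto
      then show ?thesis by (intro exI[of _ "Suc i"]) (simp add: q_def)
    qed
    have "\<forall>i<length (v # vs). obeys C (visit_at (v # vs) p i) (fst ((v # vs) ! i))"
      using v(2) vs_obeys by (auto simp: less_Suc_eq_0_disj q_def)
    moreover have "\<forall>i<length (v # vs). \<exists>t<M. visit_at (v # vs) p i = (hug C ^^ t) p"
    proof (intro allI impI)
      fix i assume "i < length (v # vs)"
      then show "\<exists>t<M. visit_at (v # vs) p i = (hug C ^^ t) p"
      proof (cases i)
        case 0
        then show ?thesis using l by (intro exI[of _ 0]) auto
      next
        case (Suc i')
        then show ?thesis using later[of i'] \<open>i < _\<close> unfolding Suc at_Suc by auto
      qed
    qed
    moreover have "\<forall>i<length (v # vs). \<forall>j<i. visit_at (v # vs) p i \<noteq> visit_at (v # vs) p j"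
      using new vs_distinct by (auto simp: less_Suc_eq_0_disj q_def)
    moreover have "(\<Sum>v\<leftarrow>v # vs. int (fst v) - int (snd v)) = (\<Sum>i<M. spin C ((hug C ^^ i) p))"
      using v(6) vs(3) sum by (simp add: l_def)
    ultimately show ?thesis using v(1) vs(1,2) cover
      unfolding itinerary_def by (intro exI[of _ "v # vs"]) (simp add: q_def)
  qed
qed

text \<open>
The walk begins at a visit of the vertex (0, m) that includes the upper side. Sliding j times from
this corner, with j at most 2, leads to the upper left corner (0, 2 m + 1); the power 4 - j goes
back j corners because four slides close up.
\<close>

definition start :: "int \<Rightarrow> nat \<Rightarrow> vertex" where
  "start m j = (slide ^^ (4 - j)) (0, 2 * m + 1)"

lemma period_exists:
  fixes f :: "'a \<Rightarrow> 'a"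
  assumes "finite S" "f ` S \<subseteq> S" "inj_on f S" "x \<in> S"
  obtains n where "0 < n" "(f ^^ n) x = x" "inj_on (\<lambda>i. (f ^^ i) x) {..<n}"
proof -
  have in_S: "(f ^^ i) x \<in> S" for i using assms(2,4) by (induction i) auto
  have cancel: "(f ^^ k) x = x" if "(f ^^ (i + k)) x = (f ^^ i) x" for i k
    using that
  proof (induction i)
    case (Suc i)
    then show ?case using inj_onD[OF assms(3) _ in_S in_S, of "i + k" i] by simp
  qed simp
  have "\<not> inj (\<lambda>i. (f ^^ i) x)"
    using in_S finite_imageD[of "\<lambda>i. (f ^^ i) x" UNIV] finite_subset[OF _ assms(1)]
    by (metis image_subsetI infinite_UNIV_nat)
  then obtain i j where "(f ^^ i) x = (f ^^ j) x" "i < j" unfolding inj_def by (metis nat_neq_iff)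
  then have ex: "0 < j - i \<and> (f ^^ (j - i)) x = x" using cancel[of i "j - i"] by simp
  define n where "n = (LEAST n. 0 < n \<and> (f ^^ n) x = x)"
  have n: "0 < n" "(f ^^ n) x = x" using LeastI[of "\<lambda>n. 0 < n \<and> (f ^^ n) x = x", OF ex] by (auto simp: n_def)
  have neq: "(f ^^ a) x \<noteq> (f ^^ b) x" if "a < b" "b < n" for a b
  proof
    assume "(f ^^ a) x = (f ^^ b) x"
    then have "0 < b - a \<and> (f ^^ (b - a)) x = x" using cancel[of a "b - a"] that by simp
    then have "n \<le> b - a" unfolding n_def by (rule Least_le)
    then show False using that by simp
  qed
  have "inj_on (\<lambda>i. (f ^^ i) x) {..<n}"
    by (rule linorder_inj_onI') (use neq in auto)
  then show thesis using n that by blast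
qed

text \<open>
The properties of a finite forward cluster that the geometry depends on. The height m is that of the
last vertex of C on the vertical axis, so nothing of C lies above (0, m) in this column.
\<close>

locale finite_cluster =
  fixes C :: "vertex set" and m :: int
  assumes finite: "finite C" and origin: "0 \<in> C"
    and reach: "\<And>x. x \<in> C \<Longrightarrow> (0, x) \<in> {(a, b). a \<in> C \<and> b \<in> C \<and> b - a \<in> units}\<^sup>*"
    and escape: "\<And>x. x \<in> C \<Longrightarrow> \<exists>d\<in>units. x + d \<in> C"
    and top: "(0, m) \<in> C" "\<And>y. m < y \<Longrightarrow> (0, y) \<notin> C"
begin

lemma m_nonneg: "0 \<le> m"
  using top(2)[of 0] origin by (force simp: zero_prod_def)

abbreviation h :: "vertex \<Rightarrow> vertex" where "h \<equiv> hug C"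

definition corners :: "vertex set" where "corners = {p. cell p \<in> C}"

lemma finite_corners: "finite corners"
proof -
  have "corners \<subseteq> (\<lambda>(x, a, b). (2 * fst x + a, 2 * snd x + b)) ` (C \<times> {0, 1} \<times> {0, 1})"
  proof
    fix p assume "p \<in> corners"
    then show "p \<in> (\<lambda>(x, a, b). (2 * fst x + a, 2 * snd x + b)) ` (C \<times> {0, 1} \<times> {0, 1})"
      by (intro image_eqI[of _ _ "(cell p, fst p mod 2, snd p mod 2)"])
        (auto simp: corners_def cell_def)
  qed
  then show ?thesis by (rule finite_subset) (use finite in auto)
qed

lemma h_corners: "h ` corners \<subseteq> corners"
  by (auto simp: corners_def hug_def)

lemma inj_h: "inj_on h corners"
  by (rule inj_on_inverseI[of _ "unhug C"]) (simp add: corners_def unhug_hug)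

lemma orbit_in_corners: "p \<in> corners \<Longrightarrow> (h ^^ i) p \<in> corners"
  by (induction i) (use h_corners in auto)

abbreviation p0 :: vertex where "p0 \<equiv> (0, 2 * m + 1)"

lemma p0: "cell p0 = (0, m)" "front p0 = (0, 1)" "p0 \<in> corners"
  using top(1) by (auto simp: cell_def front_def corners_def)

text \<open>
The corner p0 lies below an empty half-column, so the theorem of turning tangents applies to its
orbit: the walk makes exactly one clockwise turn. In terms of visits, outward corners exceed
inward turns by four.
\<close>

lemma spin_sum_top:
  assumes "(h ^^ N) p0 = p0" "inj_on (\<lambda>i. (h ^^ i) p0) {..<N}" "0 < N"
  shows "(\<Sum>i<N. spin C ((h ^^ i) p0)) = 4"
proof -
  define p where "p i = (h ^^ i) p0" for i
  define c where "c i = (\<Sum>j<i. spin C (p j))" for i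
  (* The heading of step i: a slide at a corner that faces c - 1 goes in direction c, and a pass goes in
     direction c - 1. *)
  define H where "H i = c i - of_bool (cell (p i) + front (p i) \<in> C)" for i
  have p_Suc: "p (Suc i) = h (p i)" for i by (simp add: p_def)
  have c_Suc: "c (Suc i) = c i + spin C (p i)" for i by (simp add: c_def)
  have neg: "heading (a - 2) = - heading a" for a
  proof -
    have "heading a = turn (turn (heading (a - 2)))" unfolding turn_heading by simp
    then show ?thesis by simp
  qed
  have fr: "front (p i) = heading (c i - 1)" for i
  proof (induction i)
    case 0
    then show ?case by (simp add: p_def c_def p0 heading_def)
  next
    case (Suc i)
    then show ?case using neg[of "c i"]
      by (auto simp: p_Suc c_Suc hug_def spin_def turn_heading)
  qed
  have cell_C: "cell (p i) \<in> C" for i using orbit_in_corners[OF p0(3), of i] by (simp add: p_def corners_def)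
  have "H N = 4"
  proof (rule umlaufsatz[of N p H])
    fix i
    show "p (Suc i) = p i + heading (H i)"
      by (auto simp: p_Suc hug_def H_def pass_def slide_def fr turn_heading)
    show "\<bar>H (Suc i) - H i\<bar> \<le> 1" by (auto simp: H_def c_Suc spin_def)
    fix y :: int assume "0 < y"
    show "p i \<noteq> p 0 + (0, y)"
    proof
      assume "p i = p 0 + (0, y)"
      then have "cell (p i) = (0, (2 * m + 1 + y) div 2)" by (simp add: p_def cell_def)
      then show False using cell_C[of i] top(2)[of "(2 * m + 1 + y) div 2"] \<open>0 < y\<close> by simp
    qed
  next
    show "p N = p 0" using assms by (simp add: p_def)
    then have "heading (c N - 1) = heading (c 0 - 1)" using fr[of N] fr[of 0] by simp
    then have "heading (c N) = heading (c 0)" using turn_heading[of "c N - 1"] turn_heading[of "c 0 - 1"] by simp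
    then show "heading (H N) = heading (H 0)"
      using \<open>p N = p 0\<close> \<open>heading (c N - 1) = _\<close> by (simp add: H_def)
    show "inj_on p {..<N}" using assms(2) by (simp add: p_def inj_on_def)
    show "0 < N" by fact
    show "H 0 = 0" using top(2)[of "m + 1"] by (simp add: H_def p_def c_def p0)
  qed
  moreover have "H N = c N" using assms top(2)[of "m + 1"] by (simp add: H_def p_def p0)
  ultimately show ?thesis by (simp add: c_def p_def)
qed

end

text \<open>
Steps between the two columns of corners that belong to the vertices with first coordinate a.
\<close>

definition sideways :: "int \<Rightarrow> vertex \<Rightarrow> vertex \<Rightarrow> int" where
  "sideways a u v = of_bool (fst u = 2 * a \<and> fst v = 2 * a + 1) - of_bool (fst u = 2 * a + 1 \<and> fst v = 2 * a)"

lemma even_neq_odd: "2 * x \<noteq> 2 * y + (1::int)" "2 * y + 1 \<noteq> 2 * (x::int)"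
  by presburger+

lemma sideways_hug:
  "sideways a p (hug C p) =
     (if cell p + front p \<notin> C \<and> fst (cell p) = a
      then (if front p = (0, 1) then 1 else if front p = (0, -1) then -1 else 0) else 0)"
  by (cases p rule: parity_cases;
      auto simp: sideways_def hug_def pass_def slide_def front_def turn_def cell_def even_neq_odd)

lemma sideways_potential: "sideways a p (hug C p) = of_bool (2 * a < fst (hug C p)) - of_bool (2 * a < fst p)"
proof -
  have *: "2 * a < 2 * x + 1 \<longleftrightarrow> a \<le> x" "2 * a < 2 * x + 2 \<longleftrightarrow> a \<le> x" "2 * a < 2 * x - 1 \<longleftrightarrow> a < x" for x
    by presburger+
  show ?thesis
    by (cases p rule: parity_cases;
        auto simp: sideways_def even_neq_odd cell_def front_def hug_def pass_def slide_def turn_def * of_bool_def)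
qed

context finite_cluster begin

text \<open>
The contribution of the step at p to the winding number around the centre of the block of x,
counted on the upward half-line from this centre.
\<close>

definition wind :: "vertex \<Rightarrow> vertex \<Rightarrow> int" where
  "wind x p = (if 2 * snd x < snd p then sideways (fst x) p (h p) else 0)"

lemma wind_up:
  assumes "(a, b) \<in> C" "(a, b + 1) \<in> C"
  shows "wind (a, b) p = wind (a, b + 1) p"
  using assms unfolding wind_def sideways_hug
  by (cases p rule: parity_cases; cases "snd (cell p) = b"; cases "snd (cell p) = b + 1";
      auto simp: front_def cell_def)

text \<open>
Moving the half-line one block to the right changes the count by the net flow into the strip
between the two half-lines. The walk could enter the strip vertically only along the sides shared by
the blocks of (a, b) and (a + 1, b), and these sides are not blocked.
\<close>

lemma wind_right:
  assumes "(a, b) \<in> C" "(a + 1, b) \<in> C"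
  shows "wind (a, b) p - wind (a + 1, b) p
    = of_bool (2 * a < fst (h p) \<and> fst (h p) \<le> 2 * a + 2 \<and> 2 * b < snd (h p))
      - of_bool (2 * a < fst p \<and> fst p \<le> 2 * a + 2 \<and> 2 * b < snd p)"
proof -
  have *: "2 * b < 2 * y + 1 \<longleftrightarrow> b \<le> y" "2 * b < 2 * y + 2 \<longleftrightarrow> b \<le> y" "2 * b < 2 * y - 1 \<longleftrightarrow> b < y" for y :: int
    by presburger+
  have "(2 * b < snd (h p)) = (2 * b < snd p) \<or> fst (h p) = fst p \<and> snd (cell p) = b
     \<and> (front p = (1, 0) \<or> front p = (-1, 0)) \<and> cell p + front p \<notin> C"
    by (cases p rule: parity_cases; auto simp: hug_def pass_def slide_def front_def turn_def cell_def *)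
  then consider "(2 * b < snd (h p)) = (2 * b < snd p)"
    | "fst (h p) = fst p" "\<not> (2 * a < fst p \<and> fst p \<le> 2 * a + 2)"
  proof (elim disjE conjE)
    assume blocked: "snd (cell p) = b" "cell p + front p \<notin> C" "fst (h p) = fst p"
      and "front p = (1, 0)"
    then have "fst (cell p) \<noteq> a" "fst p = 2 * fst (cell p) + 1" using assms
      by (cases p rule: parity_cases; auto simp: front_def cell_def)+
    then have "\<not> (2 * a < fst p \<and> fst p \<le> 2 * a + 2)" by presburger
    then show thesis using blocked that by blast
  next
    assume blocked: "snd (cell p) = b" "cell p + front p \<notin> C" "fst (h p) = fst p"
      and "front p = (-1, 0)"
    then have "fst (cell p) \<noteq> a + 1" "fst p = 2 * fst (cell p)" using assms
      by (cases p rule: parity_cases; auto simp: front_def cell_def)+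
    then have "\<not> (2 * a < fst p \<and> fst p \<le> 2 * a + 2)" by presburger
    then show thesis using blocked that by blast
  qed (use that in blast)
  then show ?thesis
    by cases (auto simp: wind_def sideways_potential of_bool_def)
qed

text \<open>
The walk does not separate neighbouring vertices of C, and C is connected.
\<close>

lemma wind_sum_constant:
  assumes "(h ^^ N) s = s" "x \<in> C"
  shows "(\<Sum>i<N. wind x ((h ^^ i) s)) = (\<Sum>i<N. wind 0 ((h ^^ i) s))"
proof -
  let ?W = "\<lambda>x. \<Sum>i<N. wind x ((h ^^ i) s)"
  have tele: "(\<Sum>i<N. g (h ((h ^^ i) s)) - g ((h ^^ i) s)) = 0" for g :: "vertex \<Rightarrow> int"
    using sum_lessThan_telescope[of "\<lambda>i. g ((h ^^ i) s)" N] assms(1) by simp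
  have up: "?W (a, b) = ?W (a, b + 1)" if "(a, b) \<in> C" "(a, b + 1) \<in> C" for a b
    using wind_up[OF that] by simp
  have right: "?W (a, b) = ?W (a + 1, b)" if "(a, b) \<in> C" "(a + 1, b) \<in> C" for a b
  proof -
    have "?W (a, b) - ?W (a + 1, b) = 0"
      unfolding sum_subtractf[symmetric] wind_right[OF that] by (rule tele)
    then show ?thesis by simp
  qed
  have adjacent: "?W z = ?W y" if "y \<in> C" "z \<in> C" "z - y \<in> units" for y z
  proof (cases y)
    case (Pair a b)
    have "z - y = (1, 0) \<or> z - y = (0, -1) \<or> z - y = (-1, 0) \<or> z - y = (0, 1)" using that(3) by auto
    then have "z = (a + 1, b) \<or> z = (a, b - 1) \<or> z = (a - 1, b) \<or> z = (a, b + 1)"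
      unfolding Pair by (cases z) auto
    then show ?thesis
      using that up[of a b] up[of a "b - 1"] right[of a b] right[of "a - 1" b] unfolding Pair
      by (elim disjE) auto
  qed
  show ?thesis using reach[OF assms(2)]
  proof (induction rule: rtrancl_induct)
    case (step y z)
    then show ?case using adjacent[of y z] by auto
  qed simp
qed

text \<open>
The walk winds once around (0, m): on the half-line above (0, m) it crosses at p0 only. Hence it
also winds once around the origin. Since a closed walk crosses every column with total zero, it
crosses the vertical axis at or below the origin. This is why m is bounded in terms of the length
of the walk.
\<close>

lemma orbit_reaches_origin_row:
  assumes "(h ^^ N) s = s" "s \<in> corners" "t < N" "(h ^^ t) s = p0"
  shows "\<exists>i<N. spin C ((h ^^ i) s) = 1 \<and> snd (cell ((h ^^ i) s)) \<le> 0"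
proof (rule ccontr)
  assume "\<not> ?thesis"
  then have above: "0 < snd (cell ((h ^^ i) s))" if "spin C ((h ^^ i) s) = 1" "i < N" for i
    using that by force
  have "wind 0 ((h ^^ i) s) = sideways 0 ((h ^^ i) s) (h ((h ^^ i) s))" if "i < N" for i
    using above[of i] that by (auto simp: wind_def sideways_hug spin_def cell_def)
  then have "(\<Sum>i<N. wind 0 ((h ^^ i) s))
      = (\<Sum>i<N. of_bool (0 < fst ((h ^^ Suc i) s)) - of_bool (0 < fst ((h ^^ i) s)))"
    by (intro sum.cong) (simp_all add: sideways_potential)
  also have "\<dots> = 0"
    using sum_lessThan_telescope[of "\<lambda>i. of_bool (0 < fst ((h ^^ i) s)) :: int" N] assms(1) by simp
  finally have zero: "(\<Sum>i<N. wind (0, m) ((h ^^ i) s)) = 0"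
    using wind_sum_constant[OF assms(1) top(1)] by simp
  have nonneg: "0 \<le> wind (0, m) p" if "p \<in> corners" for p
  proof -
    have "m < snd (cell p)" if "front p = (0, -1)" "2 * m < snd p"
      using that by (cases p rule: parity_cases) (auto simp: front_def cell_def)
    then show ?thesis using top(2)[of "snd (cell p)"] that
      by (cases "cell p") (auto simp: wind_def sideways_hug corners_def)
  qed
  have "wind (0, m) p0 = 1" using top(2)[of "m + 1"]
    by (simp add: wind_def sideways_hug p0)
  moreover have "wind (0, m) ((h ^^ t) s) \<le> (\<Sum>i<N. wind (0, m) ((h ^^ i) s))"
    using assms(3) by (intro member_le_sum nonneg orbit_in_corners[OF assms(2)]) auto
  ultimately show False using zero assms(4) by simp
qed

end

lemma row_next_visit:
  assumes "v \<in> visits"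
  shows "\<bar>snd (cell (next_visit v p)) - snd (cell p)\<bar> \<le> 1"
proof -
  define q where "q = (slide ^^ fst v) p"
  have "cell ((slide ^^ i) p) = cell p" for i by (induction i) auto
  then have q: "cell q = cell p" by (simp add: q_def)
  have "snd v = 1 \<or> snd v = 2" using assms by (cases v) auto
  then have "cell (next_visit v p) = cell p + front q \<or> cell (next_visit v p) = cell p + front q - turn (front q)"
    by (auto simp: next_visit_def numeral_2_eq_2 q simp flip: q_def)
  moreover have "front q = (1, 0) \<or> front q = (0, -1) \<or> front q = (-1, 0) \<or> front q = (0, 1)"
    using front_in_units[of q] by auto
  ultimately show ?thesis by (auto simp: turn_def)
qed

lemma row_run: "set vs \<subseteq> visits \<Longrightarrow> \<bar>snd (cell (run vs p)) - snd (cell p)\<bar> \<le> int (length vs)"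
proof (induction vs arbitrary: p)
  case (Cons v vs)
  then have "\<bar>snd (cell (run vs (next_visit v p))) - snd (cell (next_visit v p))\<bar> \<le> int (length vs)"
    "\<bar>snd (cell (next_visit v p)) - snd (cell p)\<bar> \<le> 1" using row_next_visit by auto
  then show ?case by simp
qed simp

text \<open>
A boundary walk may visit a vertex twice, on two opposite sides, and has no other coincidences. This
determines how much independence there is between the visits.
\<close>

definition separated :: "vertex \<Rightarrow> (nat \<times> nat) list \<Rightarrow> bool" where
  "separated p vs \<longleftrightarrow> (\<forall>i<length vs. \<forall>j<i. cell (visit_at vs p i) = cell (visit_at vs p j) \<longrightarrow>
     fst (vs ! i) = 1 \<and> fst (vs ! j) = 1 \<and> front (visit_at vs p i) = - front (visit_at vs p j))"

text \<open>
The blocked sides seen in one visit form a maximal run in the cyclic order of the four sides, and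
four sides have room for two disjoint separated runs only if both are single and opposite.
\<close>

lemma separated_visits:
  assumes "obeys C p k" "obeys C q l" "p \<noteq> q" "cell p = cell q" "1 \<le> k"
  shows "k = 1 \<and> front q = - front p"
proof -
  have neq: "front p \<noteq> front q" using assms(3,4) corner_eqI by blast
  have P: "cell p + front p \<notin> C" "cell p - turn (front p) \<in> C" 
    and Q: "cell p + front q \<notin> C" "cell p - turn (front q) \<in> C"
    using assms by (auto simp: obeys_def is_start_def)
  have "front q \<noteq> turn (front p)" using P Q by auto
  moreover have "front q \<noteq> - turn (front p)" using P Q by auto
  ultimately have opp: "front q = - front p"
    using neq front_in_units[of p] front_in_units[of q] by (auto simp: turn_def)
  have "turn (front p) \<notin> closed_sides p k" using assms(1) Q opp by (auto simp: obeys_def)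
  moreover have "turn (front p) \<in> closed_sides p k" if "1 < k"
    using that unfolding closed_sides_def by (intro image_eqI[of _ _ 1]) auto
  ultimately have "\<not> 1 < k" by blast
  then show ?thesis using opp assms(5) by simp
qed

lemma funpow_commute: "(f ^^ a) ((f ^^ b) x) = (f ^^ b) ((f ^^ a) x)"
proof -
  have "(f ^^ (a + b)) x = (f ^^ (b + a)) x" by (simp only: add.commute)
  then show ?thesis by (simp only: funpow_add o_apply)
qed

text \<open>
Necessary conditions on a boundary walk with n visits around the origin, stated for its description
by a height, an offset and a list of visits. The condition on j says that the upper side of (0, m) belongs to the first visit.
\<close>

definition circuits :: "nat \<Rightarrow> (int \<times> nat \<times> (nat \<times> nat) list) set" where
  "circuits n = {(m, j, vs). length vs = n \<and> 0 \<le> m \<and> 2 * m \<le> int n \<and> j < fst (hd vs) \<and> set vs \<subseteq> visits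
     \<and> (\<Sum>v\<leftarrow>vs. int (fst v) - int (snd v)) = 4 \<and> separated (start m j) vs}"

context finite_cluster begin

text \<open>
The walk is started at the beginning of the visit that contains the upper side of (0, m). One
period of the orbit gives the itinerary. Going from height m down to the horizontal axis and back takes
at least 2 m visits, since a visit changes the height by at most one.
\<close>

lemma circuit_exists:
  "\<exists>n j vs. 0 < n \<and> (m, j, vs) \<in> circuits n
     \<and> (\<forall>i<n. \<forall>d \<in> closed_sides (visit_at vs (start m j) i) (fst (vs ! i)).
          cell (visit_at vs (start m j) i) \<in> C \<and> cell (visit_at vs (start m j) i) + d \<notin> C)"
proof -
  have notup: "(0, m + 1) \<notin> C" using top(2) by simp
  have sl: "cell ((slide ^^ i) p0) = (0, m)" "front ((slide ^^ i) p0) = (turn ^^ i) (0, 1)" for i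
    by (induction i) (auto simp: p0)
  have t: "(turn ^^ 4) (0, 1) = (0, 1)" "(turn ^^ 3) (0, 1) = (-1, 0)" "(turn ^^ 2) (0, 1) = (0, -1)"
    by (simp_all add: turn_def numeral_eq_Suc)
  have s4: "(slide ^^ 4) p0 = p0" "slide ((slide ^^ 3) p0) = p0" "slide (slide ((slide ^^ 2) p0)) = p0"
    using slide4[of p0] by (simp_all add: numeral_eq_Suc)
  have "\<exists>j. is_start C (start m j) \<and> (h ^^ j) (start m j) = p0
      \<and> (\<forall>k. obeys C (start m j) k \<longrightarrow> 1 \<le> k \<longrightarrow> j < k)"
  proof -
    have "(-1, m) \<in> C \<or> (0, m - 1) \<in> C \<or> (1, m) \<in> C" using escape[OF top(1)] notup by auto
    then consider "(-1, m) \<in> C" | "(-1, m) \<notin> C" "(0, m - 1) \<in> C"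
      | "(-1, m) \<notin> C" "(0, m - 1) \<notin> C" "(1, m) \<in> C" by blast
    then show ?thesis
    proof cases
      case 1
      then show ?thesis using top(1) notup s4
        by (intro exI[of _ 0]) (auto simp: start_def is_start_def p0 turn_def)
    next
      case 2
      have nk: "\<not> obeys C (start m 1) 1"
        using notup by (simp add: obeys_def start_def sl t turn_def)
      have "is_start C (start m 1)" "h (start m 1) = p0"
        using 2 top(1) s4 by (simp_all add: start_def is_start_def sl t turn_def hug_def)
      moreover have "1 < k" if "obeys C (start m 1) k" "1 \<le> k" for k
        using that nk by (cases "k = 1") auto
      ultimately show ?thesis by (intro exI[of _ 1]) simp
    next
      case 3
      have nk: "\<not> obeys C (start m 2) 1" "\<not> obeys C (start m 2) 2"
        using 3 notup by (simp_all add: obeys_def start_def sl p0 t turn_def numeral_2_eq_2)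
      have "is_start C (start m 2)" "h (h (start m 2)) = p0"
        using 3 top(1) s4 by (simp_all add: start_def is_start_def sl t turn_def hug_def)
      moreover have "2 < k" if "obeys C (start m 2) k" "1 \<le> k" for k
        using that nk by (cases "k = 1"; cases "k = 2") auto
      ultimately show ?thesis by (intro exI[of _ 2]) (simp add: numeral_2_eq_2)
    qed
  qed
  then obtain j where j: "is_start C (start m j)" "(h ^^ j) (start m j) = p0"
    "\<And>k. obeys C (start m j) k \<Longrightarrow> 1 \<le> k \<Longrightarrow> j < k" by blast
  define s where "s = start m j"
  have sC: "s \<in> corners" using j(1) by (simp add: s_def is_start_def corners_def)
  obtain N where N: "0 < N" "(h ^^ N) s = s" "inj_on (\<lambda>i. (h ^^ i) s) {..<N}"
    using period_exists[OF finite_corners h_corners inj_h sC] .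
  have hj: "(h ^^ (j mod N)) s = p0" using j(2) funpow_mod_eq[OF N(2), of j] by (simp add: s_def)
  have shift: "(\<Sum>i<N. spin C ((h ^^ i) ((h ^^ l) s))) = (\<Sum>i<N. spin C ((h ^^ i) s))" for l
  proof (induction l)
    case (Suc l)
    define q where "q = (h ^^ l) s"
    have "(h ^^ N) q = q" unfolding q_def by (subst funpow_commute) (simp only: N(2))
    moreover have "(\<Sum>i<N. spin C ((h ^^ Suc i) q)) - (\<Sum>i<N. spin C ((h ^^ i) q))
        = spin C ((h ^^ N) q) - spin C q"
      using sum_lessThan_telescope[of "\<lambda>i. spin C ((h ^^ i) q)" N] by (simp add: sum_subtractf)
    ultimately have "(\<Sum>i<N. spin C ((h ^^ Suc i) q)) = (\<Sum>i<N. spin C ((h ^^ i) q))" by simp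
    moreover have "(h ^^ Suc l) s = h q" by (simp add: q_def)
    ultimately show ?case using Suc unfolding q_def[symmetric] by (simp add: funpow_swap1)
  qed simp
  have "(h ^^ N) p0 = p0" unfolding hj[symmetric] by (subst funpow_commute) (simp only: N(2))
  moreover have "inj_on (\<lambda>i. (h ^^ i) p0) {..<N}"
  proof (rule inj_onI)
    fix a b assume ab: "a \<in> {..<N}" "b \<in> {..<N}" "(h ^^ a) p0 = (h ^^ b) p0"
    define l where "l = j mod N"
    have "(h ^^ l) ((h ^^ a) s) = (h ^^ l) ((h ^^ b) s)"
      using ab(3) unfolding hj[symmetric] l_def[symmetric] by (simp only: funpow_commute[of l])
    then have "(h ^^ a) s = (h ^^ b) s"
    proof (induction l)
      case (Suc l)
      have "(h ^^ l) ((h ^^ c) s) \<in> corners" for c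
        by (intro orbit_in_corners sC)
      then show ?case using Suc inj_onD[OF inj_h] by simp
    qed simp
    then show "a = b" using inj_onD[OF N(3)] ab by blast
  qed
  ultimately have "(\<Sum>i<N. spin C ((h ^^ i) p0)) = 4" using spin_sum_top N(1) by blast
  then have four: "(\<Sum>i<N. spin C ((h ^^ i) s)) = 4" using shift[of "j mod N"] hj by simp
  have st: "is_start C s" "is_start C ((h ^^ N) s)" using j(1) N(2) by (simp_all add: s_def)
  obtain vs where it: "itinerary C s N vs" using itinerary_exists[OF st N(3)] by blast
  have vs: "set vs \<subseteq> visits" "run vs s = s" "(\<Sum>v\<leftarrow>vs. int (fst v) - int (snd v)) = 4"
    using it unfolding itinerary_def four N(2) by blast+
  have vs_obeys: "obeys C (visit_at vs s i) (fst (vs ! i))"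
    and vs_distinct: "j < i \<Longrightarrow> visit_at vs s i \<noteq> visit_at vs s j" if "i < length vs" for i j
    using it that unfolding itinerary_def by blast+
  have vs_cover: "\<exists>i<length vs. cell (visit_at vs s i) = cell ((h ^^ t) s)"
    if "t < N" "spin C ((h ^^ t) s) = 1" for t
    using it that unfolding itinerary_def by blast
  have vs_ne: "vs \<noteq> []" using vs(3) by auto
  have k1: "1 \<le> fst (vs ! i)" if "i < length vs" for i
    using vs(1) nth_mem[OF that] by (cases "vs ! i") fastforce
  have "separated s vs" unfolding separated_def
  proof (intro allI impI)
    fix a b assume ab: "a < length vs" "b < a" "cell (visit_at vs s a) = cell (visit_at vs s b)"
    then have "b < length vs" by simp
    show "fst (vs ! a) = 1 \<and> fst (vs ! b) = 1 \<and> front (visit_at vs s a) = - front (visit_at vs s b)"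
      using separated_visits[OF vs_obeys[OF ab(1)] vs_obeys[OF \<open>b < length vs\<close>] vs_distinct[OF ab(1,2)] ab(3) k1[OF ab(1)]]
        separated_visits[OF vs_obeys[OF \<open>b < length vs\<close>] vs_obeys[OF ab(1)] vs_distinct[OF ab(1,2), symmetric]
          ab(3)[symmetric] k1[OF \<open>b < length vs\<close>]] by simp
  qed
  moreover have "j < fst (hd vs)"
    using j(3) vs_obeys[of 0] k1[of 0] vs_ne by (simp add: hd_conv_nth s_def)
  moreover have "2 * m \<le> int (length vs)"
  proof -
    obtain t where t: "t < N" "spin C ((h ^^ t) s) = 1" "snd (cell ((h ^^ t) s)) \<le> 0"
      using orbit_reaches_origin_row[OF N(2) sC _ hj] N(1) by auto
    obtain i where i: "i < length vs" "snd (cell (visit_at vs s i)) \<le> 0"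
      using vs_cover[OF t(1,2)] t(3) by auto
    have cs: "snd (cell s) = m" by (simp add: s_def start_def sl)
    have "run (drop i vs) (visit_at vs s i) = s" using vs(2) run_append[of "take i vs" "drop i vs" s] by simp
    moreover have "set (take i vs) \<subseteq> visits" "set (drop i vs) \<subseteq> visits"
      using vs(1) set_take_subset[of i vs] set_drop_subset[of i vs] by (meson subset_trans)+
    ultimately have "\<bar>snd (cell (visit_at vs s i)) - m\<bar> \<le> int i"
      "\<bar>m - snd (cell (visit_at vs s i))\<bar> \<le> int (length vs - i)"
      using row_run[of "take i vs" s] row_run[of "drop i vs" "visit_at vs s i"] i(1) cs by simp_all
    then show ?thesis using i by simp
  qed
  ultimately have "(m, j, vs) \<in> circuits (length vs)"
    using vs(1,3) m_nonneg by (simp add: circuits_def s_def)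
  moreover have "cell (visit_at vs s i) \<in> C \<and> cell (visit_at vs s i) + d \<notin> C"
    if "i < length vs" "d \<in> closed_sides (visit_at vs s i) (fst (vs ! i))" for i d
    using vs_obeys[OF that(1)] that(2) by (auto simp: obeys_def is_start_def)
  ultimately show ?thesis using vs_ne
    by (intro exI[of _ "length vs"] exI[of _ j] exI[of _ vs]) (simp add: s_def)
qed

end

section \<open>Probability that the sides of a boundary walk are closed\<close>

lemma measure_bind_pmf: "measure_pmf.prob (bind_pmf p f) A = (\<integral>x. measure_pmf.prob (f x) A \<partial>measure_pmf p)"
proof -
  have "ennreal (measure_pmf.prob (bind_pmf p f) A) = (\<integral>\<^sup>+x. ennreal (measure_pmf.prob (f x) A) \<partial>measure_pmf p)"
    unfolding measure_pmf.emeasure_eq_measure[symmetric] by (rule emeasure_bind_pmf)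
  also have "\<dots> = ennreal (\<integral>x. measure_pmf.prob (f x) A \<partial>measure_pmf p)"
    by (intro nn_integral_eq_integral measure_pmf.integrable_const_bound[where B=1]) auto
  finally show ?thesis by (simp add: integral_nonneg_AE)
qed

lemma prob_stick:
  assumes "0 \<le> e" "e \<le> 1"
  shows "measure_pmf.prob (stick_pmf e) A =
    e / 2 * (indicator A {(1, 0), (-1, 0)} + indicator A {(0, 1), (0, -1)})
    + (1 - e) / 4 * (\<Sum>d\<in>units. indicator A {d})"
proof -
  have c: "card {Horizontal, Vertical} = 2" "card {(1::int, 0::int), (-1, 0)} = 2" "card {(0::int, 1::int), (0, -1)} = 2"
    by simp_all
  show ?thesis using assms
    by (simp add: stick_pmf_def measure_bind_pmf integral_pmf_of_set measure_return c field_simps)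
qed

lemma stick_support:
  assumes "0 \<le> e" "e \<le> 1"
  shows "AE s in stick_pmf e. s \<noteq> {} \<and> s \<subseteq> units"
proof -
  have "measure_pmf.prob (stick_pmf e) {s. s \<noteq> {} \<and> s \<subseteq> units} = 1"
    using assms by (simp add: prob_stick field_simps)
  then show ?thesis using measure_pmf.prob_eq_1[of "{s. s \<noteq> {} \<and> s \<subseteq> units}" "stick_pmf e"] by simp
qed

lemma stick_support_0: "AE s in stick_pmf 0. \<exists>d\<in>units. s = {d}"
proof -
  have "measure_pmf.prob (stick_pmf 0) {s. \<exists>d\<in>units. s = {d}} = 1"
    by (simp add: prob_stick)
  then show ?thesis using measure_pmf.prob_eq_1[of "{s. \<exists>d\<in>units. s = {d}}" "stick_pmf 0"] by simp
qed

definition closed_prob :: "real \<Rightarrow> vertex set \<Rightarrow> real" where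
  "closed_prob e D = measure_pmf.prob (stick_pmf e) {s. s \<inter> D = {}}"

text \<open>
With e at least 99/100, two or three prescribed sides that are not just an opposite pair are closed
with probability (1 - e)/2 or (1 - e)/4. A single side is closed with probability close to 1/2, but
two opposite sides are closed together with probability 1/2 as well; the weight of a single side
therefore has to be at least the square root of 1/2.
\<close>

definition weight :: "nat \<Rightarrow> real" where
  "weight k = (if k = 1 then 708 / 1000 else if k = 2 then 5 / 1000 else 25 / 10000)"

lemma closed_prob_bounds:
  assumes "99/100 \<le> e" "e \<le> 1" "f \<in> units"
  shows "closed_prob e {f} \<le> 708 / 1000" "closed_prob e {f, - f} \<le> (708 / 1000)\<^sup>2"
    "closed_prob e {f, turn f} \<le> 5 / 1000" "closed_prob e {f, turn f, - f} \<le> 25 / 10000"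
proof -
  have "f = (1, 0) \<or> f = (0, -1) \<or> f = (-1, 0) \<or> f = (0, 1)" using assms(3) by auto
  then have "closed_prob e {f} \<le> 708 / 1000 \<and> closed_prob e {f, - f} \<le> (708 / 1000)\<^sup>2
    \<and> closed_prob e {f, turn f} \<le> 5 / 1000 \<and> closed_prob e {f, turn f, - f} \<le> 25 / 10000"
    using assms(1,2)
    by (elim disjE; simp add: closed_prob_def prob_stick turn_def indicator_def power2_eq_square field_simps)
  then show "closed_prob e {f} \<le> 708 / 1000" "closed_prob e {f, - f} \<le> (708 / 1000)\<^sup>2"
    "closed_prob e {f, turn f} \<le> 5 / 1000" "closed_prob e {f, turn f, - f} \<le> 25 / 10000" by auto
qed

lemma closed_prob_visit:
  assumes "99/100 \<le> e" "e \<le> 1" "k \<in> {1..3}"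
  shows "closed_prob e (closed_sides p k) \<le> weight k"
proof -
  have "k = 1 \<or> k = 2 \<or> k = 3" using assms(3) by auto
  then show ?thesis
    using closed_prob_bounds[OF assms(1,2) front_in_units[of p]]
    by (auto simp: weight_def closed_sides_def lessThan_Suc numeral_2_eq_2 numeral_3_eq_3 insert_commute)
qed

lemma space_sticks: "space (soft_stick_measure e) = UNIV"
  by (simp add: soft_stick_measure_def space_PiM)

lemma prob_space_sticks: "prob_space (soft_stick_measure e)"
  unfolding soft_stick_measure_def by (intro prob_space_PiM measure_pmf.prob_space_axioms)

lemma cylinder_measurable:
  assumes "finite J"
  shows "{w. \<forall>x\<in>J. w x \<in> A x} \<in> sets (soft_stick_measure e)"
proof -
  have "{w \<in> space (soft_stick_measure e). w x \<in> A x} \<in> sets (soft_stick_measure e)" for x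
    unfolding soft_stick_measure_def by (rule sets_Collect_single') auto
  then have "{w \<in> space (soft_stick_measure e). \<forall>x\<in>J. w x \<in> A x} \<in> sets (soft_stick_measure e)"
    by (intro sets.sets_Collect_finite_All assms)
  then show ?thesis by (simp add: space_sticks)
qed

lemma prob_cylinder:
  assumes "finite J"
  shows "measure (soft_stick_measure e) {w. \<forall>x\<in>J. w x \<in> A x} = (\<Prod>x\<in>J. measure_pmf.prob (stick_pmf e) (A x))"
proof -
  interpret product_prob_space "\<lambda>_::vertex. measure_pmf (stick_pmf e)" UNIV
    by unfold_locales
  have "emeasure (soft_stick_measure e) {w. \<forall>x\<in>J. w x \<in> A x} = (\<Prod>x\<in>J. emeasure (stick_pmf e) (A x))"
    using emeasure_PiM_Collect[of J A] assms space_sticks[of e] by (simp add: soft_stick_measure_def)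
  also have "\<dots> = ennreal (\<Prod>x\<in>J. measure_pmf.prob (stick_pmf e) (A x))"
    by (simp add: measure_pmf.emeasure_eq_measure prod_ennreal)
  finally show ?thesis by (simp add: measure_def prod_nonneg)
qed

definition circuit_closed :: "vertex \<Rightarrow> (nat \<times> nat) list \<Rightarrow> (vertex \<Rightarrow> vertex set) set" where
  "circuit_closed p vs = {w. \<forall>i<length vs.
     w (cell (visit_at vs p i)) \<inter> closed_sides (visit_at vs p i) (fst (vs ! i)) = {}}"

text \<open>
Grouping the conditions by vertices exhibits the event as a finite cylinder.
\<close>

lemma circuit_closed_cylinder:
  "circuit_closed p vs = {w. \<forall>x \<in> (\<lambda>i. cell (visit_at vs p i)) ` {..<length vs}.
     w x \<in> {s. \<forall>i<length vs. cell (visit_at vs p i) = x \<longrightarrow>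
       s \<inter> closed_sides (visit_at vs p i) (fst (vs ! i)) = {}}}"
  unfolding circuit_closed_def
proof (intro Collect_cong iffI ballI CollectI allI impI)
  fix w x i
  assume "\<forall>i<length vs. w (cell (visit_at vs p i)) \<inter> closed_sides (visit_at vs p i) (fst (vs ! i)) = {}"
    and "i < length vs" "cell (visit_at vs p i) = x"
  then show "w x \<inter> closed_sides (visit_at vs p i) (fst (vs ! i)) = {}" by blast
qed blast

text \<open>
Different vertices are independent. A vertex with two visits imposes the condition that an opposite
pair of sides is closed, and the square of the weight of a single side covers this case.
\<close>

lemma prob_circuit_closed:
  assumes e: "99/100 \<le> e" "e \<le> 1" and sep: "separated p vs" and vs: "set vs \<subseteq> visits"
  shows "measure (soft_stick_measure e) (circuit_closed p vs) \<le> (\<Prod>v\<leftarrow>vs. weight (fst v))"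
proof -
  define P where "P = visit_at vs p"
  define k where "k i = fst (vs ! i)" for i
  define D where "D i = closed_sides (P i) (k i)" for i
  define n where "n = length vs"
  define A where "A x = {s. \<forall>i<n. cell (P i) = x \<longrightarrow> s \<inter> D i = {}}" for x
  have k: "k i \<in> {1..3}" if "i < n" for i
    using vs nth_mem[of i vs] that by (cases "vs ! i") (fastforce simp: k_def n_def)
  have sep': "k i = 1 \<and> k j = 1 \<and> front (P i) = - front (P j)"
    if "i < n" "j < n" "i \<noteq> j" "cell (P i) = cell (P j)" for i j
    using sep that unfolding separated_def P_def k_def n_def
    by (metis linorder_neqE_nat minus_minus)
  have site: "measure_pmf.prob (stick_pmf e) (A x) \<le> (\<Prod>i\<in>{i\<in>{..<n}. cell (P i) = x}. weight (k i))"
    if "x \<in> (\<lambda>i. cell (P i)) ` {..<n}" for x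
  proof -
    obtain i where i: "i < n" "cell (P i) = x" using \<open>x \<in> _\<close> by auto
    define I where "I = {i\<in>{..<n}. cell (P i) = x}"
    show ?thesis
    proof (cases "I = {i}")
      case True
      have "measure_pmf.prob (stick_pmf e) (A x) \<le> closed_prob e (D i)"
        unfolding closed_prob_def by (intro measure_pmf.finite_measure_mono) (use i in \<open>auto simp: A_def\<close>)
      also have "\<dots> \<le> weight (k i)" unfolding D_def by (rule closed_prob_visit[OF e k[OF i(1)]])
      finally show ?thesis using True unfolding I_def by simp
    next
      case False
      have "i \<in> I" using i by (simp add: I_def)
      then obtain j where j: "j < n" "cell (P j) = x" "j \<noteq> i" using False by (auto simp: I_def)
      have ij: "k i = 1" "k j = 1" "front (P j) = - front (P i)" using sep'[of j i] i j by auto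
      have "I \<subseteq> {i, j}"
      proof
        fix l assume "l \<in> I"
        then have l: "l < n" "cell (P l) = x" by (auto simp: I_def)
        show "l \<in> {i, j}"
        proof (rule ccontr)
          assume "l \<notin> {i, j}"
          then have "front (P l) = - front (P i)" "front (P l) = - front (P j)"
            using sep'[of l i] sep'[of l j] l i j by auto
          then have "front (P i) = - front (P i)" using ij(3) by simp
          then show False using front_in_units[of "P i"] by auto
        qed
      qed
      then have I: "I = {i, j}" using i j by (auto simp: I_def)
      have "A x \<subseteq> {s. s \<inter> {front (P i), - front (P i)} = {}}"
      proof
        fix s assume "s \<in> A x"
        then have "s \<inter> D i = {}" "s \<inter> D j = {}" using i j by (auto simp: A_def)
        then show "s \<in> {s. s \<inter> {front (P i), - front (P i)} = {}}"
          using ij by (auto simp: D_def closed_sides_def)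
      qed
      then have "measure_pmf.prob (stick_pmf e) (A x) \<le> closed_prob e {front (P i), - front (P i)}"
        unfolding closed_prob_def by (intro measure_pmf.finite_measure_mono) auto
      also have "\<dots> \<le> (708 / 1000)\<^sup>2" by (rule closed_prob_bounds(2)[OF e front_in_units])
      finally show ?thesis using ij j(3) unfolding I_def[symmetric] I
        by (simp add: weight_def power2_eq_square)
    qed
  qed
  have "measure (soft_stick_measure e) (circuit_closed p vs)
      = (\<Prod>x\<in>(\<lambda>i. cell (P i)) ` {..<n}. measure_pmf.prob (stick_pmf e) (A x))"
    unfolding circuit_closed_cylinder P_def n_def A_def D_def k_def by (rule prob_cylinder) simp
  also have "\<dots> \<le> (\<Prod>x\<in>(\<lambda>i. cell (P i)) ` {..<n}. \<Prod>i\<in>{i\<in>{..<n}. cell (P i) = x}. weight (k i))"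
    by (rule prod_mono, intro conjI measure_nonneg site)
  also have "\<dots> = (\<Prod>i<n. weight (k i))" by (rule prod.group) auto
  also have "\<dots> = (\<Prod>v\<leftarrow>vs. weight (fst v))"
    by (simp add: prod.list_conv_set_nth n_def k_def lessThan_atLeast0)
  finally show ?thesis .
qed

lemma circuit_closed_measurable: "circuit_closed p vs \<in> sets (soft_stick_measure e)"
  unfolding circuit_closed_cylinder by (rule cylinder_measurable) simp

section \<open>Summation over all boundary walks\<close>

lemma sum_lists_prod_list:
  fixes g :: "'a \<Rightarrow> 'b :: comm_semiring_1"
  assumes "finite V"
  shows "(\<Sum>vs | set vs \<subseteq> V \<and> length vs = n. \<Prod>v\<leftarrow>vs. g v) = (\<Sum>v\<in>V. g v) ^ n"
proof (induction n)
  case 0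
  have "{vs. set vs \<subseteq> V \<and> length vs = 0} = {[]}" by auto
  then show ?case by simp
next
  case (Suc n)
  let ?L = "{vs. set vs \<subseteq> V \<and> length vs = n}"
  have "(\<Sum>vs | set vs \<subseteq> V \<and> length vs = Suc n. \<Prod>v\<leftarrow>vs. g v) = (\<Sum>(v, vs)\<in>V \<times> ?L. g v * (\<Prod>v\<leftarrow>vs. g v))"
    by (rule sum.reindex_bij_witness[of _ "\<lambda>(v, vs). v # vs" "\<lambda>vs. (hd vs, tl vs)"])
      (auto simp: length_Suc_conv)
  also have "\<dots> = (\<Sum>v\<in>V. g v) * (\<Sum>vs\<in>?L. \<Prod>v\<leftarrow>vs. g v)"
    by (simp add: sum_product sum.cartesian_product)
  finally show ?case using Suc by simp
qed

text \<open>
Inward turns are free while outward corners are expensive, so the plain weights do not sum to less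
than one per visit. Along a circuit the exponents k - l add up to 4, so multiplying each weight by
6 to the power k - l changes the weight of a circuit by the factor 6 to the power 4 only. A
larger base improves this factor and worsens the total per visit; the base 6 keeps both small enough.
\<close>

definition tilted :: "nat \<times> nat \<Rightarrow> real" where
  "tilted v = weight (fst v) * 6 powi (int (fst v) - int (snd v))"

lemma prod_tilted:
  "(\<Prod>v\<leftarrow>vs. tilted v) = (\<Prod>v\<leftarrow>vs. weight (fst v)) * 6 powi (\<Sum>v\<leftarrow>vs. int (fst v) - int (snd v))"
  by (induction vs) (simp_all add: tilted_def power_int_add)

lemma weight_pos: "0 < weight k" by (simp add: weight_def)

lemma tilted_pos: "0 < tilted v" by (simp add: tilted_def weight_pos)

lemma visits_eq: "visits = {(1,1),(1,2),(2,1),(2,2),(3,1),(3,2)}"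
  by auto

text \<open>
The second sum belongs to the first visit: it counts the k possible positions j of the upper side of
(0, m) within the visit.
\<close>

lemma tilted_sums:
  "(\<Sum>v\<in>visits. tilted v) = 966 / 1000"
  "(\<Sum>v\<in>visits. real (fst v) * tilted v) = 1211 / 1000"
  unfolding visits_eq by (simp_all add: tilted_def weight_def power_int_def)

lemma circuits_subset:
  "circuits (Suc n) \<subseteq> (\<lambda>((m, v, j), vs). (int m, j, v # vs)) `
     (({..(n + 1) div 2} \<times> (SIGMA v:visits. {..<fst v})) \<times> {vs. set vs \<subseteq> visits \<and> length vs = n})"
proof
  fix c assume "c \<in> circuits (Suc n)"
  then obtain m j ws where c: "c = (m, j, ws)" "length ws = Suc n" "0 \<le> m" "2 * m \<le> int (Suc n)"
    "j < fst (hd ws)" "set ws \<subseteq> visits" by (auto simp: circuits_def)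
  then obtain v vs where ws: "ws = v # vs" by (cases ws) auto
  have "nat m \<le> (n + 1) div 2" "m = int (nat m)" using c by auto
  then show "c \<in> (\<lambda>((m, v, j), vs). (int m, j, v # vs)) `
     (({..(n + 1) div 2} \<times> (SIGMA v:visits. {..<fst v})) \<times> {vs. set vs \<subseteq> visits \<and> length vs = n})"
    using c unfolding ws
    by (intro image_eqI[of _ _ "((nat m, v, j), vs)"]) auto
qed

lemma finite_circuits: "finite (circuits (Suc n))"
  by (rule finite_subset[OF circuits_subset]) (auto intro!: finite_lists_length_eq finite_SigmaI)

lemma sum_circuits:
  "(\<Sum>(m, j, vs)\<in>circuits (Suc n). \<Prod>v\<leftarrow>vs. weight (fst v))
     \<le> 1211 / 1000 / 6 ^ 4 * (real (Suc n) * (966 / 1000) ^ n / 2 + (966 / 1000) ^ n)"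
proof -
  define L where "L = {vs. set vs \<subseteq> visits \<and> length vs = n}"
  define S where "S = (SIGMA v:visits. {..<fst v})"
  define f where "f = (\<lambda>((m::nat, v::nat \<times> nat, j::nat), vs). (int m, j, v # vs))"
  define F where "F = (\<lambda>(m::int, j::nat, vs). (\<Prod>v\<leftarrow>vs. tilted v) / 6 ^ 4)"
  have fin: "finite L" "finite S" unfolding L_def S_def by (auto intro!: finite_lists_length_eq)
  have "(\<Sum>(m, j, vs)\<in>circuits (Suc n). \<Prod>v\<leftarrow>vs. weight (fst v)) = (\<Sum>c\<in>circuits (Suc n). F c)"
    by (intro sum.cong refl) (auto simp: circuits_def F_def prod_tilted)
  also have "\<dots> \<le> (\<Sum>c\<in>f ` (({..(n + 1) div 2} \<times> S) \<times> L). F c)"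
  proof (rule sum_mono2)
    show "circuits (Suc n) \<subseteq> f ` (({..(n + 1) div 2} \<times> S) \<times> L)"
      using circuits_subset unfolding f_def S_def L_def by simp
    show "0 \<le> F c" for c
      by (cases c) (auto simp: F_def intro!: prod_list_nonneg less_imp_le[OF tilted_pos])
  qed (use fin in auto)
  also have "\<dots> = (\<Sum>x\<in>({..(n + 1) div 2} \<times> S) \<times> L. F (f x))"
    by (rule sum.reindex_cong[of f]) (auto simp: f_def inj_on_def)
  also have "\<dots> = (\<Sum>m\<le>(n + 1) div 2. \<Sum>(v, j)\<in>S. \<Sum>vs\<in>L. tilted v * (\<Prod>v\<leftarrow>vs. tilted v) / 6 ^ 4)"
    by (simp add: sum.cartesian_product' f_def F_def case_prod_unfold)
  also have "\<dots> = real ((n + 1) div 2 + 1) * ((\<Sum>(v, j)\<in>S. tilted v) * (\<Sum>vs\<in>L. \<Prod>v\<leftarrow>vs. tilted v) / 6 ^ 4)"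
    by (simp add: sum_divide_distrib sum_product case_prod_unfold)
  also have "(\<Sum>(v, j)\<in>S. tilted v) = (\<Sum>v\<in>visits. \<Sum>j<fst v. tilted v)"
    unfolding S_def by (rule sum.Sigma[symmetric]) auto
  also have "\<dots> = 1211 / 1000" using tilted_sums(2) by simp
  also have "(\<Sum>vs\<in>L. \<Prod>v\<leftarrow>vs. tilted v) = (966 / 1000) ^ n"
    unfolding L_def tilted_sums(1)[symmetric] by (rule sum_lists_prod_list) simp
  also have "real ((n + 1) div 2 + 1) * (1211 / 1000 * (966 / 1000) ^ n / 6 ^ 4)
      \<le> (real (Suc n) / 2 + 1) * (1211 / 1000 * (966 / 1000) ^ n / 6 ^ 4)"
    by (intro mult_right_mono) (auto simp: field_simps)
  finally show ?thesis by (simp add: field_simps)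
qed

text \<open>
The value of the series is about 0.4316.
\<close>

lemma bound_sums:
  "(\<lambda>n. 1211 / 1000 / 6 ^ 4 * (real (Suc n) * (966 / 1000) ^ n / 2 + (966 / 1000) ^ n)) sums
     (1211 / 1000 / 6 ^ 4 * (1 / (1 - 966 / 1000)\<^sup>2 / 2 + 1 / (1 - 966 / 1000)))"
  by (intro sums_mult sums_add sums_divide geometric_deriv_sums geometric_sums) auto

section \<open>The lower bound for the percolation probability\<close>

lemma forward_cluster_subset:
  assumes "x \<in> F" "\<And>y d. y \<in> F \<Longrightarrow> d \<in> w y \<Longrightarrow> y + d \<in> F"
  shows "forward_cluster w x \<subseteq> F"
proof
  fix z assume "z \<in> forward_cluster w x"
  then have "(x, z) \<in> (open_arrows w)\<^sup>*" by (simp add: forward_cluster_def)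
  then show "z \<in> F"
    by (induction rule: rtrancl_induct) (use assms in \<open>auto simp: open_arrows_def\<close>)
qed

lemma forward_cluster_closed: "y \<in> forward_cluster w x \<Longrightarrow> d \<in> w y \<Longrightarrow> y + d \<in> forward_cluster w x"
proof -
  assume "y \<in> forward_cluster w x" "d \<in> w y"
  then have "(x, y) \<in> (open_arrows w)\<^sup>*" "(y, y + d) \<in> open_arrows w"
    unfolding forward_cluster_def open_arrows_def by blast+
  then show ?thesis by (auto simp: forward_cluster_def intro: rtrancl_into_rtrancl)
qed

lemma self_in_forward_cluster: "x \<in> forward_cluster w x"
  by (simp add: forward_cluster_def)

text \<open>
Countably many finite sets can trap the cluster, and each traps it on a cylinder event; hence
finiteness of the cluster is measurable.
\<close>

lemma finite_cluster_eq:
  "{w. finite (forward_cluster w 0)}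
    = (\<Union>F\<in>{F. finite F \<and> 0 \<in> F}. {w. \<forall>x\<in>F. w x \<in> {s. \<forall>d\<in>s. x + d \<in> F}})"
proof safe
  fix w :: "vertex \<Rightarrow> vertex set" assume "finite (forward_cluster w 0)"
  then show "w \<in> (\<Union>F\<in>{F. finite F \<and> 0 \<in> F}. {w. \<forall>x\<in>F. w x \<in> {s. \<forall>d\<in>s. x + d \<in> F}})"
    using self_in_forward_cluster[of 0 w] forward_cluster_closed[of _ w 0] by blast
next
  fix w :: "vertex \<Rightarrow> vertex set" and F :: "vertex set"
  assume F: "finite F" "0 \<in> F" "\<forall>x\<in>F. w x \<in> {s. \<forall>d\<in>s. x + d \<in> F}"
  show "finite (forward_cluster w 0)"
    by (rule finite_subset[OF forward_cluster_subset]) (use F in auto)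
qed

lemma finite_cluster_measurable: "{w. finite (forward_cluster w 0)} \<in> sets (soft_stick_measure e)"
  unfolding finite_cluster_eq
proof (rule sets.countable_UN'')
  have "countable (Collect finite :: vertex set set)" by (rule countable_Collect_finite)
  then show "countable {F :: vertex set. finite F \<and> 0 \<in> F}" by (rule countable_subset[rotated]) auto
  show "{w. \<forall>x\<in>F. w x \<in> {s. \<forall>d\<in>s. x + d \<in> F}} \<in> sets (soft_stick_measure e)"
    if "F \<in> {F. finite F \<and> 0 \<in> F}" for F
    by (rule cylinder_measurable) (use that in simp)
qed

lemma circuit_surrounds_finite_cluster:
  assumes supp: "\<And>x. w x \<noteq> {} \<and> w x \<subseteq> units" and fin: "finite (forward_cluster w 0)"
  shows "\<exists>n. \<exists>(m, j, vs)\<in>circuits (Suc n). w \<in> circuit_closed (start m j) vs"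
proof -
  define C where "C = forward_cluster w 0"
  define Y where "Y = {y. (0, y) \<in> C}"
  have "finite (Pair (0::int) -` C)" by (rule finite_vimageI) (use fin in \<open>auto simp: C_def inj_on_def\<close>)
  moreover have "Y = Pair 0 -` C" by (auto simp: Y_def)
  ultimately have Y: "finite Y" "Y \<noteq> {}"
    using self_in_forward_cluster[of 0 w] by (auto simp: Y_def C_def zero_prod_def)
  define m where "m = Max Y"
  interpret finite_cluster C m
  proof
    show "finite C" "0 \<in> C" using fin self_in_forward_cluster by (auto simp: C_def)
    show "(0, x) \<in> {(a, b). a \<in> C \<and> b \<in> C \<and> b - a \<in> units}\<^sup>*" if "x \<in> C" for x
    proof -
      have "(0, x) \<in> (open_arrows w)\<^sup>*" using that by (simp add: C_def forward_cluster_def)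
      then show ?thesis
      proof (induction rule: rtrancl_induct)
        case (step y z)
        then have "y \<in> C" "z \<in> C" by (auto simp: C_def forward_cluster_def intro: rtrancl_into_rtrancl)
        moreover have "z - y \<in> units" using step(2) supp[of y] by (auto simp: open_arrows_def)
        ultimately show ?case using step(3) by (auto intro: rtrancl_into_rtrancl)
      qed simp
    qed
    show "\<exists>d\<in>units. x + d \<in> C" if "x \<in> C" for x
    proof -
      obtain d where "d \<in> w x" using supp[of x] by auto
      then show ?thesis using supp[of x] forward_cluster_closed[of x w 0 d] that by (auto simp: C_def)
    qed
    show "(0, m) \<in> C" using Max_in[OF Y] by (simp add: m_def Y_def)
    show "(0, y) \<notin> C" if "m < y" for y
      using Max_ge[OF Y(1), of y] that by (auto simp: m_def Y_def)
  qed
  obtain n j vs where c: "0 < n" "(m, j, vs) \<in> circuits n"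
    "\<And>i d. i < n \<Longrightarrow> d \<in> closed_sides (visit_at vs (start m j) i) (fst (vs ! i)) \<Longrightarrow>
          cell (visit_at vs (start m j) i) \<in> C \<and> cell (visit_at vs (start m j) i) + d \<notin> C"
    using circuit_exists by blast
  have "length vs = n" using c(2) by (simp add: circuits_def)
  have "w \<in> circuit_closed (start m j) vs"
    unfolding circuit_closed_def
  proof (intro CollectI allI impI)
    fix i assume "i < length vs"
    then have i: "i < n" using \<open>length vs = n\<close> by simp
    show "w (cell (visit_at vs (start m j) i)) \<inter> closed_sides (visit_at vs (start m j) i) (fst (vs ! i)) = {}"
      using c(3)[OF i] forward_cluster_closed[of "cell (visit_at vs (start m j) i)" w 0] unfolding C_def by blast
  qed
  then show ?thesis using c(1,2) by (intro exI[of _ "n - 1"] bexI[of _ "(m, j, vs)"]) auto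
qed

lemma AE_sticks:
  assumes "AE s in stick_pmf e. P s"
  shows "AE w in soft_stick_measure e. \<forall>x. P (w x)"
  unfolding AE_all_countable
proof
  fix x
  show "AE w in soft_stick_measure e. P (w x)"
    unfolding soft_stick_measure_def
    by (rule AE_PiM_component) (use assms measure_pmf.prob_space_axioms in auto)
qed

lemma percolation_prob_eq: "percolation_prob e = 1 - measure (soft_stick_measure e) {w. finite (forward_cluster w 0)}"
proof -
  interpret prob_space "soft_stick_measure e" by (rule prob_space_sticks)
  have "{w \<in> space (soft_stick_measure e). infinite (forward_cluster w 0)}
      = space (soft_stick_measure e) - {w. finite (forward_cluster w 0)}" by auto
  then show ?thesis unfolding percolation_prob_def using prob_compl[OF finite_cluster_measurable] by simp
qed

text \<open>
Peierls argument: a finite cluster is surrounded by a circuit with closed sides, and the expected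
number of such circuits is less than 9/20.
\<close>

theorem percolation_lower_bound:
  assumes "99/100 \<le> e" "e \<le> 1"
  shows "11/20 < percolation_prob e"
proof -
  interpret prob_space "soft_stick_measure e" by (rule prob_space_sticks)
  define U where "U n = (\<Union>(m, j, vs)\<in>circuits (Suc n). circuit_closed (start m j) vs)" for n
  define b :: "nat \<Rightarrow> real" where
    "b n = 1211 / 1000 / 6 ^ 4 * (real (Suc n) * (966 / 1000) ^ n / 2 + (966 / 1000) ^ n)" for n
  have U_meas: "U n \<in> sets (soft_stick_measure e)" for n
    unfolding U_def by (intro sets.finite_UN finite_circuits) (auto intro: circuit_closed_measurable)
  have U_le: "prob (U n) \<le> b n" for n
  proof -
    have "prob (U n) \<le> (\<Sum>c\<in>circuits (Suc n). prob (case c of (m, j, vs) \<Rightarrow> circuit_closed (start m j) vs))"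
      unfolding U_def by (rule finite_measure_subadditive_finite[OF finite_circuits])
        (auto intro: circuit_closed_measurable)
    also have "\<dots> \<le> (\<Sum>(m, j, vs)\<in>circuits (Suc n). \<Prod>v\<leftarrow>vs. weight (fst v))"
      by (rule sum_mono) (auto simp: circuits_def intro!: prob_circuit_closed assms)
    also have "\<dots> \<le> b n" unfolding b_def by (rule sum_circuits)
    finally show ?thesis .
  qed
  have b: "summable b" "suminf b < 9 / 20"
    using bound_sums unfolding b_def[symmetric] by (simp_all add: sums_iff power2_eq_square)
  have sU: "summable (\<lambda>n. prob (U n))"
    by (rule summable_comparison_test'[OF b(1), of 0]) (use U_le in auto)
  have "AE w in soft_stick_measure e. \<forall>x. w x \<noteq> {} \<and> w x \<subseteq> units"
    using stick_support assms by (intro AE_sticks) auto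
  then have "AE w in soft_stick_measure e. w \<in> {w. finite (forward_cluster w 0)} \<longrightarrow> w \<in> (\<Union>n. U n)"
  proof (rule eventually_mono)
    fix w :: "vertex \<Rightarrow> vertex set" assume "\<forall>x. w x \<noteq> {} \<and> w x \<subseteq> units"
    then show "w \<in> {w. finite (forward_cluster w 0)} \<longrightarrow> w \<in> (\<Union>n. U n)"
      using circuit_surrounds_finite_cluster[of w] unfolding U_def by fastforce
  qed
  then have "prob {w. finite (forward_cluster w 0)} \<le> prob (\<Union>n. U n)"
    by (rule finite_measure_mono_AE) (use U_meas in auto)
  also have "\<dots> \<le> (\<Sum>n. prob (U n))"
    by (rule finite_measure_subadditive_countably) (use U_meas sU in auto)
  also have "\<dots> \<le> suminf b" by (rule suminf_le[OF U_le sU b(1)])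
  also have "\<dots> < 9 / 20" by (rule b(2))
  finally show ?thesis by (simp add: percolation_prob_eq)
qed

section \<open>No percolation without soft vertices\<close>

text \<open>
The percolation probability at e = 0 matters because a supremum of reals is meaningful only over a
nonempty set. At e = 0 each vertex has exactly one open arrow, so the cluster is a single path. If it
is infinite it never revisits a vertex, and in particular it never reverses a step. There are at
most 4 * 3 ^ n such paths with n + 1 steps, each of probability (1/4) ^ (n + 1).
\<close>

definition unreversed :: "nat \<Rightarrow> vertex list set" where
  "unreversed n = {ds. length ds = n \<and> set ds \<subseteq> units \<and> (\<forall>i. Suc i < n \<longrightarrow> ds ! Suc i \<noteq> - ds ! i)}"

lemma finite_unreversed: "finite (unreversed n)"
  by (rule finite_subset[OF _ finite_lists_length_eq[of units n]]) (auto simp: unreversed_def)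

lemma card_unreversed: "card (unreversed (Suc n)) \<le> 4 * 3 ^ n"
proof (induction n)
  case 0
  have "unreversed (Suc 0) \<subseteq> (\<lambda>d. [d]) ` units"
    by (auto simp: unreversed_def length_Suc_conv)
  then have "card (unreversed (Suc 0)) \<le> card ((\<lambda>d. [d]) ` units)" by (rule card_mono[rotated]) simp
  also have "\<dots> \<le> card units" by (rule card_image_le) simp
  finally show ?case by simp
next
  case (Suc n)
  have "unreversed (Suc (Suc n)) \<subseteq> (\<Union>ds\<in>unreversed (Suc n). (\<lambda>d. d # ds) ` (units - {- hd ds}))"
  proof
    fix es assume es: "es \<in> unreversed (Suc (Suc n))"
    then obtain d ds where ds: "es = d # ds" "length ds = Suc n" by (auto simp: unreversed_def length_Suc_conv)
    have "ds ! Suc i \<noteq> - ds ! i" if "Suc i < Suc n" for i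
      using es that unfolding ds unreversed_def by (auto dest: spec[of _ "Suc i"])
    then have "ds \<in> unreversed (Suc n)" using es ds by (auto simp: unreversed_def)
    moreover have "ds \<noteq> []" "es ! Suc 0 \<noteq> - es ! 0" using ds(2) es by (auto simp: unreversed_def)
    then have "d \<noteq> - hd ds" using ds by (auto simp: hd_conv_nth)
    moreover have "d \<in> units" using es ds by (simp add: unreversed_def)
    ultimately show "es \<in> (\<Union>ds\<in>unreversed (Suc n). (\<lambda>d. d # ds) ` (units - {- hd ds}))"
      using ds(1) by blast
  qed
  then have "card (unreversed (Suc (Suc n)))
      \<le> card (\<Union>ds\<in>unreversed (Suc n). (\<lambda>d. d # ds) ` (units - {- hd ds}))"
    by (intro card_mono) (simp_all add: finite_unreversed)
  also have "\<dots> \<le> (\<Sum>ds\<in>unreversed (Suc n). card ((\<lambda>d. d # ds) ` (units - {- hd ds})))"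
    by (rule card_UN_le[OF finite_unreversed])
  also have "\<dots> \<le> (\<Sum>ds\<in>unreversed (Suc n). 3)"
  proof (rule sum_mono)
    fix ds assume "ds \<in> unreversed (Suc n)"
    then have "hd ds \<in> units" using hd_in_set[of ds] by (fastforce simp: unreversed_def)
    then have "- hd ds \<in> units" by auto
    then have "card (units - {- hd ds}) = 3" by (subst card_Diff_singleton) auto
    then show "card ((\<lambda>d. d # ds) ` (units - {- hd ds})) \<le> 3"
      using card_image_le[of "units - {- hd ds}" "\<lambda>d. d # ds"] by simp
  qed
  also have "\<dots> \<le> 4 * 3 ^ Suc n" using Suc by simp
  finally show ?case .
qed

definition follows :: "vertex list \<Rightarrow> (vertex \<Rightarrow> vertex set) set" where
  "follows ds = {w. \<forall>x \<in> (\<lambda>i. sum_list (take i ds)) ` {..<length ds}.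
     w x \<in> {s. \<forall>i<length ds. sum_list (take i ds) = x \<longrightarrow> s = {ds ! i}}}"

lemma follows_measurable: "follows ds \<in> sets (soft_stick_measure e)"
  unfolding follows_def by (rule cylinder_measurable) simp

lemma prob_follows:
  assumes "set ds \<subseteq> units" "inj_on (\<lambda>i. sum_list (take i ds)) {..<length ds}"
  shows "measure (soft_stick_measure 0) (follows ds) \<le> (1 / 4) ^ length ds"
proof -
  define P where "P i = sum_list (take i ds)" for i
  have site: "measure_pmf.prob (stick_pmf 0) {s. \<forall>j<length ds. P j = P i \<longrightarrow> s = {ds ! j}} \<le> 1 / 4"
    if "i < length ds" for i
  proof -
    have "ds ! i \<in> units" using assms(1) nth_mem[OF that] by (rule subsetD)
    then have "measure_pmf.prob (stick_pmf 0) {{ds ! i}} = 1 / 4"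
      by (auto simp: prob_stick indicator_def)
    moreover have "measure_pmf.prob (stick_pmf 0) {s. \<forall>j<length ds. P j = P i \<longrightarrow> s = {ds ! j}}
        \<le> measure_pmf.prob (stick_pmf 0) {{ds ! i}}"
      by (rule measure_pmf.finite_measure_mono) (use that in auto)
    ultimately show ?thesis by simp
  qed
  have "measure (soft_stick_measure 0) (follows ds)
      = (\<Prod>x\<in>P ` {..<length ds}. measure_pmf.prob (stick_pmf 0) {s. \<forall>j<length ds. P j = x \<longrightarrow> s = {ds ! j}})"
    unfolding follows_def P_def by (rule prob_cylinder) simp
  also have "\<dots> = (\<Prod>i<length ds. measure_pmf.prob (stick_pmf 0) {s. \<forall>j<length ds. P j = P i \<longrightarrow> s = {ds ! j}})"
    using prod.reindex[of P "{..<length ds}"] assms(2) by (simp add: P_def[abs_def])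
  also have "\<dots> \<le> (\<Prod>i<length ds. 1 / 4)"
    by (rule prod_mono, intro conjI measure_nonneg site) simp
  finally show ?thesis by simp
qed

text \<open>
A path of single arrows that revisits a vertex is periodic from there on, and its cluster is finite.
\<close>

lemma infinite_single_stick_path:
  assumes single: "\<And>x. \<exists>d\<in>units. w x = {d}" and inf: "infinite (forward_cluster w 0)"
  shows "\<exists>ds\<in>unreversed n. inj_on (\<lambda>i. sum_list (take i ds)) {..<n} \<and> w \<in> follows ds"
proof -
  define \<delta> where "\<delta> x = the_elem (w x)" for x
  have \<delta>: "w x = {\<delta> x}" "\<delta> x \<in> units" for x
  proof -
    obtain d where "d \<in> units" "w x = {d}" using single by blast
    then show "w x = {\<delta> x}" "\<delta> x \<in> units" by (simp_all only: \<delta>_def the_elem_eq)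
  qed
  define X where "X i = ((\<lambda>x. x + \<delta> x) ^^ i) 0" for i
  have X: "X 0 = 0" "X (Suc i) = X i + \<delta> (X i)" for i by (simp_all add: X_def)
  have neq: "X i \<noteq> X j" if "i < j" for i j
  proof
    assume eq: "X i = X j"
    have "forward_cluster w 0 \<subseteq> X ` {..<j}"
    proof (rule forward_cluster_subset)
      show "0 \<in> X ` {..<j}" using that X(1) by (intro image_eqI[of _ _ 0]) auto
      fix y d assume "y \<in> X ` {..<j}" "d \<in> w y"
      then obtain k where k: "k < j" "y + d = X (Suc k)" using \<delta>(1) X(2) by auto
      show "y + d \<in> X ` {..<j}"
      proof (cases "Suc k = j")
        case True
        then show ?thesis using k eq that by (intro image_eqI[of _ _ i]) auto
      next
        case False
        then show ?thesis using k by (intro image_eqI[of _ _ "Suc k"]) auto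
      qed
    qed
    then show False using inf finite_subset by blast
  qed
  define ds where "ds = map (\<lambda>i. \<delta> (X i)) [0..<n]"
  have pos: "sum_list (take i ds) = X i" if "i \<le> n" for i
    using that
  proof (induction i)
    case (Suc i)
    then show ?case by (simp add: ds_def take_Suc_conv_app_nth X)
  qed (simp add: X)
  have nth: "ds ! i = \<delta> (X i)" if "i < n" for i using that by (simp add: ds_def)
  have "ds ! Suc i \<noteq> - ds ! i" if "Suc i < n" for i
  proof
    assume "ds ! Suc i = - ds ! i"
    then have "X (Suc (Suc i)) = X i" using that nth[of i] nth[of "Suc i"] X(2)[of i] X(2)[of "Suc i"] by simp
    then show False using neq[of i "Suc (Suc i)"] by simp
  qed
  moreover have "set ds \<subseteq> units" unfolding ds_def set_map by (rule image_subsetI) (rule \<delta>(2))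
  ultimately have "ds \<in> unreversed n" by (simp add: unreversed_def ds_def)
  moreover have "inj_on (\<lambda>i. sum_list (take i ds)) {..<n}"
    by (rule linorder_inj_onI') (use pos neq in auto)
  moreover have "w \<in> follows ds"
  proof -
    have "length ds = n" by (simp add: ds_def)
    then show ?thesis using \<delta>(1) nth pos by (auto simp: follows_def)
  qed
  ultimately show ?thesis by blast
qed

lemma percolation_prob_0: "percolation_prob 0 = 0"
proof -
  interpret prob_space "soft_stick_measure 0" by (rule prob_space_sticks)
  have bound: "percolation_prob 0 \<le> (3 / 4) ^ n" for n
  proof -
    define S where "S = {ds \<in> unreversed (Suc n). inj_on (\<lambda>i. sum_list (take i ds)) {..<Suc n}}"
    have S: "finite S" unfolding S_def using finite_unreversed by simp
    have U: "(\<Union>ds\<in>S. follows ds) \<in> sets (soft_stick_measure 0)"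
      using S follows_measurable by auto
    have "AE w in soft_stick_measure 0. \<forall>x. \<exists>d\<in>units. w x = {d}"
      by (intro AE_sticks stick_support_0)
    then have "AE w in soft_stick_measure 0. w \<in> {w \<in> space (soft_stick_measure 0). infinite (forward_cluster w 0)}
        \<longrightarrow> w \<in> (\<Union>ds\<in>S. follows ds)"
    proof (rule eventually_mono)
      fix w :: "vertex \<Rightarrow> vertex set" assume "\<forall>x. \<exists>d\<in>units. w x = {d}"
      then show "w \<in> {w \<in> space (soft_stick_measure 0). infinite (forward_cluster w 0)}
        \<longrightarrow> w \<in> (\<Union>ds\<in>S. follows ds)"
        using infinite_single_stick_path[of w "Suc n"] by (auto simp: S_def)
    qed
    then have "percolation_prob 0 \<le> prob (\<Union>ds\<in>S. follows ds)"
      unfolding percolation_prob_def by (rule finite_measure_mono_AE) (rule U)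
    also have "\<dots> \<le> (\<Sum>ds\<in>S. prob (follows ds))"
      by (rule finite_measure_subadditive_finite[OF S]) (use follows_measurable in auto)
    also have "\<dots> \<le> (\<Sum>ds\<in>S. (1 / 4) ^ Suc n)"
    proof (rule sum_mono)
      fix ds assume "ds \<in> S"
      then show "prob (follows ds) \<le> (1 / 4) ^ Suc n"
        using prob_follows[of ds] by (simp add: S_def unreversed_def)
    qed
    also have "\<dots> = real (card S) * (1 / 4) ^ Suc n" by simp
    also have "card S \<le> 4 * 3 ^ n"
      using card_mono[OF finite_unreversed, of S "Suc n"] card_unreversed[of n] by (auto simp: S_def)
    then have "real (card S) * (1 / 4) ^ Suc n \<le> real (4 * 3 ^ n) * (1 / 4) ^ Suc n"
      by (intro mult_right_mono) (simp_all del: of_nat_mult of_nat_power)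
    also have "\<dots> = (3 / 4) ^ n" by (simp add: power_divide)
    finally show ?thesis .
  qed
  have "(\<lambda>n. (3 / 4 :: real) ^ n) \<longlonglongrightarrow> 0" by (rule LIMSEQ_power_zero) simp
  then have "percolation_prob 0 \<le> 0" by (rule LIMSEQ_le_const) (use bound in auto)
  moreover have "0 \<le> percolation_prob 0" by (simp add: percolation_prob_def)
  ultimately show ?thesis by simp
qed

section \<open>The critical parameter\<close>

theorem theorem1:
  shows "percolation_prob (99/100) > 11/20
       \<and> critical_parameter \<le> 99/100
       \<and> critical_parameter < 1"
proof -
  have "critical_parameter \<le> 99/100"
    unfolding critical_parameter_def
  proof (rule cSup_least)
    show "{e \<in> {0..1}. percolation_prob e = 0} \<noteq> {}" using percolation_prob_0 by force
    fix e assume "e \<in> {e \<in> {0..1}. percolation_prob e = 0}"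
    then show "e \<le> 99/100" using percolation_lower_bound[of e] by (cases "e \<le> 99/100") auto
  qed
  then show ?thesis using percolation_lower_bound[of "99/100"] by auto
qed

end
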